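(* Let $(p_n)_{n\in\mathbb{N}}$ be a sequence of positive integers with $p_n\to\infty$ as $n\to\infty$. Let $s,t\in(0,1]$ be fixed and let $(a_n)$ be a sequence of positive real numbers with $\sqrt n=o(a_n)$ and $a_n=o(np_n)$. Then $$X_n=\frac{H_n(s,t)-\mathbb{E}[H_n(s,t)]}{a_n}$$ satisfies a large deviation principle with speed $b_n=\frac{a_n^2}{n}$ and good rate function $$I(x)=x^2\Big(s^2\int_0^t\Big(\frac{t-y}{1-y}\Big)^2dy\Big)^{-1}.$$
   Context: For each $n$, let $p_{2n+1,i,j}$ ($1\le i\le 2n$, $0\le j\le p_n-1$) and $r_{2n+1,i,j}$ ($1\le i\le 2n$, $1\le j\le p_n-1$) be independent random variables with $$p_{2n+1,i,j}\sim\beta\Big(\tfrac{p_n+1}{2}(2n-i+2)-\tfrac j2,\ \tfrac{p_n+1}{2}(2n-i+2)\Big),\qquad r_{2n+1,i,j}\sim\beta\Big(\tfrac{p_n+1}{2}(2n-i+2)-\tfrac j2,\ \tfrac j2\Big),$$ where $\beta(\cdot,\cdot)$ is the Beta distribution on $[0,1]$. For $s,t\in[0,1]$ define $$\begin{aligned}H_n(s,t)=\sum_{i=1}^{\lfloor nt\rfloor}\Big\{&\sum_{j=1}^{\lfloor p_ns\rfloor-1}\Big(\log\big(r_{2n+1,2i,j}^{\lfloor nt\rfloor-i}\big)+\log\big(r_{2n+1,2i-1,j}^{\lfloor nt\rfloor-i+1}\big)\Big)\\&+\sum_{j=0}^{\lfloor p_ns\rfloor-1}\log\big(p_{2n+1,2i,j}^{\lfloor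 nt\rfloor-i+1}(1-p_{2n+1,2i,j})^{\lfloor nt\rfloor-i}\big)\\&+\sum_{j=0}^{\lfloor p_ns\rfloor-1}\log\big(p_{2n+1,2i-1,j}^{\lfloor nt\rfloor-i+1}(1-p_{2n+1,2i-1,j})^{\lfloor nt\rfloor-i+1}\big)\Big\},\end{aligned}$$ with empty sums equal to $0$ and $H_n(0,t)=0$. The large deviation principle is the usual one on $\mathbb{R}$: with speed $b_n\to\infty$ and rate function $I$, for all Borel sets $B$, $-\inf_{x\in B^\circ}I(x)\le\liminf_n b_n^{-1}\log\mathbb{P}(X_n\in B)\le\limsup_n b_n^{-1}\log\mathbb{P}(X_n\in B)\le-\inf_{x\in\overline B}I(x)$; $I$ is good if its sublevel sets are compact. *)

theory Defs
  imports "HOL-Probability.Probability" "HOL-Library.Landau_Symbols"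
begin

definition beta_density :: "real \<Rightarrow> real \<Rightarrow> real \<Rightarrow> real" where
  "beta_density a b x =
     (if 0 < x \<and> x < 1 then x powr (a - 1) * (1 - x) powr (b - 1) / Beta a b else 0)"

definition log_prob :: "real \<Rightarrow> ereal" where
  "log_prob x = (if x = 0 then - \<infinity> else ereal (ln x))"

text \<open>The spaces \<open>M n\<close> may differ, since an LDP only concerns the laws of the \<open>X n\<close>.
  Infima and limits are taken in the extended reals, so the infimum over the empty set
  is \<open>\<infinity>\<close>.\<close>

definition satisfies_LDP ::
  "(nat \<Rightarrow> 'a measure) \<Rightarrow> (nat \<Rightarrow> 'a \<Rightarrow> real) \<Rightarrow> (nat \<Rightarrow> real) \<Rightarrow> (real \<Rightarrow> ereal) \<Rightarrow> bool" where
  "satisfies_LDP M X b I \<longleftrightarrow>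
     (\<forall>n. X n \<in> borel_measurable (M n)) \<and>
     filterlim b at_top sequentially \<and>
     (\<forall>B \<in> sets borel.
        - (INF x \<in> interior B. I x)
          \<le> liminf (\<lambda>n. log_prob (measure (M n) {\<omega> \<in> space (M n). X n \<omega> \<in> B}) / ereal (b n)) \<and>
        limsup (\<lambda>n. log_prob (measure (M n) {\<omega> \<in> space (M n). X n \<omega> \<in> B}) / ereal (b n))
          \<le> - (INF x \<in> closure B. I x))"

text \<open>Compactness of all sublevel sets already implies lower semicontinuity.\<close>

definition good_rate_function :: "(real \<Rightarrow> ereal) \<Rightarrow> bool" where
  "good_rate_function I \<longleftrightarrow> (\<forall>x. 0 \<le> I x) \<and> (\<forall>c::real. compact {x. I x \<le> ereal c})"

text \<open>Below, \<open>q\<close> is the integer \<open>p\<^sub>n\<close>, and \<open>P i j\<close>, \<open>R i j\<close> are the random variables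
  \<open>p\<^bsub>2n+1,i,j\<^esub>\<close>, \<open>r\<^bsub>2n+1,i,j\<^esub>\<close>. All shape parameters are positive on the index ranges
  used here.\<close>

definition P_index :: "nat \<Rightarrow> nat \<Rightarrow> (nat \<times> nat) set" where
  "P_index n q = {1..2*n} \<times> {0..<q}"

definition R_index :: "nat \<Rightarrow> nat \<Rightarrow> (nat \<times> nat) set" where
  "R_index n q = {1..2*n} \<times> {1..<q}"

definition beta_array ::
  "'a measure \<Rightarrow> nat \<Rightarrow> nat \<Rightarrow> (nat \<Rightarrow> nat \<Rightarrow> 'a \<Rightarrow> real) \<Rightarrow> (nat \<Rightarrow> nat \<Rightarrow> 'a \<Rightarrow> real) \<Rightarrow> bool" where
  "beta_array M n q P R \<longleftrightarrow>
     (\<forall>(i, j) \<in> P_index n q. distributed M lborel (P i j)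
        (\<lambda>x. ennreal (beta_density
           ((real q + 1) / 2 * (2 * real n - real i + 2) - real j / 2)
           ((real q + 1) / 2 * (2 * real n - real i + 2)) x))) \<and>
     (\<forall>(i, j) \<in> R_index n q. distributed M lborel (R i j)
        (\<lambda>x. ennreal (beta_density
           ((real q + 1) / 2 * (2 * real n - real i + 2) - real j / 2)
           (real j / 2) x))) \<and>
     prob_space.indep_vars M (\<lambda>_. borel)
       (case_sum (\<lambda>(i, j). P i j) (\<lambda>(i, j). R i j)) (P_index n q <+> R_index n q)"

text \<open>Half-open ranges \<open>{0..<m}\<close>, \<open>{1..<m}\<close> are used for \<open>j \<le> m - 1\<close> so that the sums are
  empty for \<open>m = 0\<close> despite truncated subtraction; the subtractions \<open>k - i\<close> and
  \<open>2 * i - 1\<close> never truncate, as \<open>1 \<le> i \<le> k\<close>.\<close>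

definition H ::
  "nat \<Rightarrow> nat \<Rightarrow> (nat \<Rightarrow> nat \<Rightarrow> 'a \<Rightarrow> real) \<Rightarrow> (nat \<Rightarrow> nat \<Rightarrow> 'a \<Rightarrow> real)
    \<Rightarrow> real \<Rightarrow> real \<Rightarrow> 'a \<Rightarrow> real" where
  "H n q P R s t \<omega> =
     (let k = nat \<lfloor>real n * t\<rfloor>; m = nat \<lfloor>real q * s\<rfloor> in
      \<Sum>i\<in>{1..k}.
        (\<Sum>j\<in>{1..<m}. ln (R (2*i) j \<omega> ^ (k - i)) + ln (R (2*i - 1) j \<omega> ^ (k - i + 1)))
      + (\<Sum>j\<in>{0..<m}. ln (P (2*i) j \<omega> ^ (k - i + 1) * (1 - P (2*i) j \<omega>) ^ (k - i)))
      + (\<Sum>j\<in>{0..<m}. ln (P (2*i - 1) j \<omega> ^ (k - i + 1) * (1 - P (2*i - 1) j \<omega>) ^ (k - i + 1))))"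

end

theory Submission
  imports Defs
begin

text \<open>The cumulant generating function of a logarithm of Beta variables is an explicit combination of
  values of \<open>ln \<circ> \<Gamma>\<close>, so its second derivative is a combination of trigamma values, and
  \<open>1/x \<le> \<psi>'(x) \<le> 1/x + 1/x\<^sup>2\<close> is precise enough to sum it. Since \<open>a\<^sub>n = o(n p\<^sub>n)\<close>, the
  argument \<open>u a\<^sub>n / n\<close> is small against all shape parameters, so the second derivatives may
  uniformly be replaced by their values at \<open>0\<close>. To leading order only the variables \<open>r\<close>
  contribute; their variances form a Riemann sum for \<open>((t - y)/(1 - y))\<^sup>2\<close>. Hence the scaled cumulant
  generating functions converge to a quadratic function, and a Gaertner-Ellis argument applies.\<close>

section \<open>The Gaertner-Ellis theorem with quadratic limit\<close>

text \<open>Orders of magnitude decide which variables matter. With \<open>N i\<close> = (2n - i +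
  2)/2, row i has large shape parameters of size about \<open>q * N i\<close> and exponents at most
  \<open>N i\<close>. For a \<open>p\<close>, both shapes nearly agree and so do both exponents; the
  three trigamma terms then cancel down to order 1/(q N i) + 1/q^2. Over q columns, 1/N i and 1/q
  remain per row, which is o(n) in total. For an \<open>r\<close>, the variance is about d^2 (j/2) /
  \<alpha>^2, at most of order j/q^2, and a row adds up to order 1. With J the integral in the rate
  function, 2n rows of mean size J times s^2/4 give the variance n v with v = s^2 J / 2, whence the
  rate x^2 / (2 v). Two places resist a uniform treatment. If t = 1, \<open>N i\<close> comes down
  to about 1 in the last rows, so errors of order 1/N i are kept row by row and summed. The second
  shape of \<open>r\<close> is j/2, possibly just 1/2; this is harmless because 1 - r has exponent
  0, so the trigamma term at j/2 has weight 0.\<close>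

lemma log_prob_le_iff:
  assumes "b > 0" "p \<ge> 0"
  shows "log_prob p / ereal b \<le> ereal c \<longleftrightarrow> p \<le> exp (b * c)"
proof (cases "p = 0")
  case True
  then show ?thesis using assms by (simp add: log_prob_def)
next
  case False
  then have "p > 0" using assms by simp
  then have "ln p \<le> b * c \<longleftrightarrow> p \<le> exp (b * c)"
    by (metis exp_ln exp_le_cancel_iff)
  then show ?thesis using False assms by (simp add: log_prob_def divide_le_eq mult.commute)
qed

text \<open>Together with \<open>log_prob_le_iff\<close> this confines the extended reals to limsup
  and liminf: all else compares a probability with a real exponential. The case
  \<open>p = 0\<close>, where \<open>log_prob\<close> is minus infinity, is covered by both
  equivalences.\<close>

lemma le_log_prob_iff:
  assumes "b > 0" "p \<ge> 0"
  shows "ereal c \<le> log_prob p / ereal b \<longleftrightarrow> exp (b * c) \<le> p"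
proof (cases "p = 0")
  case True
  then show ?thesis using assms by (simp add: log_prob_def not_le)
next
  case False
  then have "p > 0" using assms by simp
  then have "b * c \<le> ln p \<longleftrightarrow> exp (b * c) \<le> p"
    by (metis exp_ln exp_le_cancel_iff)
  then show ?thesis using False assms by (simp add: log_prob_def le_divide_eq mult.commute)
qed

text \<open>The limiting rate is even and increasing in |x|, so only the distance of
  \<open>B\<close> from 0 counts. The sum of both exponentials dominates the indicators of both
  tails at once, which avoids splitting \<open>B\<close> by sign at the price of a factor 2.\<close>

lemma (in prob_space) two_sided_chernoff:
  assumes X: "X \<in> borel_measurable M" and B: "B \<in> sets borel"
    and d: "\<And>x. x \<in> B \<Longrightarrow> d \<le> \<bar>x\<bar>" and u: "u \<ge> 0"
    and i1: "integrable M (\<lambda>\<omega>. exp (u * X \<omega>))" and i2: "integrable M (\<lambda>\<omega>. exp (- u * X \<omega>))"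
  shows "prob {\<omega> \<in> space M. X \<omega> \<in> B}
    \<le> exp (- u * d) * (expectation (\<lambda>\<omega>. exp (u * X \<omega>)) + expectation (\<lambda>\<omega>. exp (- u * X \<omega>)))"
proof -
  let ?S = "{\<omega> \<in> space M. X \<omega> \<in> B}"
  have S: "?S \<in> sets M" using X B by measurable
  have "prob ?S = expectation (indicator ?S)"
    using S by simp
  also have "\<dots> \<le> expectation (\<lambda>\<omega>. exp (- u * d) * (exp (u * X \<omega>) + exp (- u * X \<omega>)))"
  proof (rule integral_mono)
    show "integrable M (indicat_real ?S)"
      by (rule integrable_real_indicator[OF S]) (simp add: emeasure_eq_measure)
    show "integrable M (\<lambda>\<omega>. exp (- u * d) * (exp (u * X \<omega>) + exp (- u * X \<omega>)))"
      by (intro integrable_mult_right Bochner_Integration.integrable_add i1 i2)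
    fix \<omega> assume "\<omega> \<in> space M"
    show "indicat_real ?S \<omega> \<le> exp (- u * d) * (exp (u * X \<omega>) + exp (- u * X \<omega>))"
    proof (cases "X \<omega> \<in> B")
      case True
      have "u * d \<le> u * \<bar>X \<omega>\<bar>" using d[OF True] u by (rule mult_left_mono)
      then have "exp (u * d) \<le> exp (u * \<bar>X \<omega>\<bar>)" by simp
      also have "\<dots> \<le> exp (u * X \<omega>) + exp (- u * X \<omega>)"
        by (cases "X \<omega> \<ge> 0") auto
      finally have "exp (- u * d) * exp (u * d) \<le> exp (- u * d) * (exp (u * X \<omega>) + exp (- u * X \<omega>))"
        by (intro mult_left_mono) auto
      then have "1 \<le> exp (- u * d) * (exp (u * X \<omega>) + exp (- u * X \<omega>))"
        by (simp flip: exp_add)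
      then show ?thesis by (simp add: indicator_def)
    qed (simp add: add_nonneg_nonneg)
  qed
  finally show ?thesis using i1 i2 by simp
qed

text \<open>The lower bound by exponential tilting, with the tail estimate under the tilted measure
  written out as a pointwise inequality so that no change of measure is needed.\<close>

lemma (in prob_space) tilted_lower_bound:
  assumes X: "X \<in> borel_measurable M" and B: "B \<in> sets borel"
    and \<delta>: "\<delta> > 0" "\<And>y. \<bar>y - x\<bar> < \<delta> \<Longrightarrow> y \<in> B" and w: "w \<ge> 0"
    and i0: "integrable M (\<lambda>\<omega>. exp (u * X \<omega>))"
    and i1: "integrable M (\<lambda>\<omega>. exp ((u + w) * X \<omega>))"
    and i2: "integrable M (\<lambda>\<omega>. exp ((u - w) * X \<omega>))"
  shows "expectation (\<lambda>\<omega>. exp (u * X \<omega>))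
      - exp (- w * (x + \<delta>)) * expectation (\<lambda>\<omega>. exp ((u + w) * X \<omega>))
      - exp (w * (x - \<delta>)) * expectation (\<lambda>\<omega>. exp ((u - w) * X \<omega>))
    \<le> exp (u * x + \<bar>u\<bar> * \<delta>) * prob {\<omega> \<in> space M. X \<omega> \<in> B}"
proof -
  let ?S = "{\<omega> \<in> space M. X \<omega> \<in> B}"
  have S: "?S \<in> sets M" using X B by measurable
  have iS: "integrable M (indicat_real ?S)"
    by (rule integrable_real_indicator[OF S]) (simp add: emeasure_eq_measure)
  let ?L = "\<lambda>\<omega>. exp (u * X \<omega>) - exp (- w * (x + \<delta>)) * exp ((u + w) * X \<omega>)
      - exp (w * (x - \<delta>)) * exp ((u - w) * X \<omega>)"
  have "expectation ?L \<le> expectation (\<lambda>\<omega>. exp (u * x + \<bar>u\<bar> * \<delta>) * indicat_real ?S \<omega>)"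
  proof (rule integral_mono)
    show "integrable M ?L"
      by (intro Bochner_Integration.integrable_diff integrable_mult_right i0 i1 i2)
    show "integrable M (\<lambda>\<omega>. exp (u * x + \<bar>u\<bar> * \<delta>) * indicat_real ?S \<omega>)"
      by (intro integrable_mult_right iS)
    fix \<omega> assume \<omega>: "\<omega> \<in> space M"
    have e1: "exp (- w * (x + \<delta>)) * exp ((u + w) * X \<omega>) = exp (u * X \<omega>) * exp (w * (X \<omega> - x - \<delta>))"
      by (simp flip: exp_add add: algebra_simps)
    have e2: "exp (w * (x - \<delta>)) * exp ((u - w) * X \<omega>) = exp (u * X \<omega>) * exp (w * (x - \<delta> - X \<omega>))"
      by (simp flip: exp_add add: algebra_simps)
    \<comment> \<open>At distance at least \<open>\<delta>\<close> from \<open>x\<close>, one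
      subtracted term alone is at least \<open>exp (u * X \<omega>)\<close>, so \<open>?L\<close> is
      nonpositive. Inside the ball both subtracted terms are dropped.\<close>
    consider "X \<omega> - x \<ge> \<delta>" | "x - X \<omega> \<ge> \<delta>" | "\<bar>X \<omega> - x\<bar> < \<delta>" by linarith
    then show "?L \<omega> \<le> exp (u * x + \<bar>u\<bar> * \<delta>) * indicat_real ?S \<omega>"
    proof cases
      case 1
      then have "exp (w * (X \<omega> - x - \<delta>)) \<ge> 1" using w by simp
      then have "exp (u * X \<omega>) * 1 \<le> exp (u * X \<omega>) * exp (w * (X \<omega> - x - \<delta>))"
        by (intro mult_left_mono) auto
      then have "?L \<omega> \<le> 0" unfolding e1 e2 by (smt (verit) mult_nonneg_nonneg exp_ge_zero mult_cancel_left2)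
      also have "0 \<le> exp (u * x + \<bar>u\<bar> * \<delta>) * indicat_real ?S \<omega>" by simp
      finally show ?thesis .
    next
      case 2
      then have "exp (w * (x - \<delta> - X \<omega>)) \<ge> 1" using w by simp
      then have "exp (u * X \<omega>) * 1 \<le> exp (u * X \<omega>) * exp (w * (x - \<delta> - X \<omega>))"
        by (intro mult_left_mono) auto
      then have "?L \<omega> \<le> 0" unfolding e1 e2 by (smt (verit) mult_nonneg_nonneg exp_ge_zero mult_cancel_left2)
      also have "0 \<le> exp (u * x + \<bar>u\<bar> * \<delta>) * indicat_real ?S \<omega>" by simp
      finally show ?thesis .
    next
      case 3
      then have "X \<omega> \<in> B" using \<delta> by blast
      then have ind: "indicat_real ?S \<omega> = 1" using \<omega> by simp
      have "u * (X \<omega> - x) \<le> \<bar>u\<bar> * \<bar>X \<omega> - x\<bar>" by (metis abs_ge_self abs_mult)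
      also have "\<dots> \<le> \<bar>u\<bar> * \<delta>" using 3 by (intro mult_left_mono) auto
      finally have "u * X \<omega> \<le> u * x + \<bar>u\<bar> * \<delta>" by (simp add: algebra_simps)
      then have "exp (u * X \<omega>) \<le> exp (u * x + \<bar>u\<bar> * \<delta>)" by simp
      then show ?thesis unfolding ind
        by (smt (verit) mult_nonneg_nonneg exp_ge_zero mult_cancel_left2)
    qed
  qed
  then show ?thesis using i0 i1 i2 S by simp
qed

text \<open>\<open>mgf\<close> is only asked eventually, with a threshold depending on
  \<open>u\<close>, since the exponential moments are finite only near 0. This suffices because each
  bound uses finitely many arguments: \<open>u\<close> and \<open>-u\<close> for the upper one,
  \<open>u\<close>, \<open>u + w\<close> and \<open>u - w\<close> for the lower one.\<close>

lemma LDP_quadratic: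
  fixes M :: "nat \<Rightarrow> 'a measure" and X :: "nat \<Rightarrow> 'a \<Rightarrow> real" and L :: "real \<Rightarrow> nat \<Rightarrow> real"
  assumes v: "v > 0"
    and X: "\<And>n. X n \<in> borel_measurable (M n)"
    and prob: "\<forall>\<^sub>F n in sequentially. prob_space (M n)"
    and b: "filterlim b at_top sequentially"
    and mgf: "\<And>u. \<forall>\<^sub>F n in sequentially. integrable (M n) (\<lambda>\<omega>. exp (u * b n * X n \<omega>)) \<and>
      (\<integral>\<omega>. exp (u * b n * X n \<omega>) \<partial>M n) = exp (b n * L u n)"
    and lim: "\<And>u. L u \<longlonglongrightarrow> u\<^sup>2 * v / 2"
  shows "satisfies_LDP M X b (\<lambda>x. ereal (x\<^sup>2 / (2 * v)))"
  unfolding satisfies_LDP_def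
proof (intro conjI allI ballI)
  let ?P = "\<lambda>B n. measure (M n) {\<omega> \<in> space (M n). X n \<omega> \<in> B}"
  have bpos: "\<forall>\<^sub>F n in sequentially. b n > 0"
    using b by (simp add: filterlim_at_top_dense)
  have Lle: "\<forall>\<^sub>F n in sequentially. L u n \<le> u\<^sup>2 * v / 2 + e" if "e > 0" for u e
    using order_tendstoD(2)[OF lim[of u], of "u\<^sup>2 * v / 2 + e"] that by (auto elim: eventually_mono)
  have Lge: "\<forall>\<^sub>F n in sequentially. u\<^sup>2 * v / 2 - e \<le> L u n" if "e > 0" for u e
    using order_tendstoD(1)[OF lim[of u], of "u\<^sup>2 * v / 2 - e"] that by (auto elim: eventually_mono)
  fix B :: "real set" assume B: "B \<in> sets borel"
  show "limsup (\<lambda>n. log_prob (?P B n) / ereal (b n)) \<le> - (INF x \<in> closure B. ereal (x\<^sup>2 / (2 * v)))"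
  proof (cases "B = {}")
    case True
    have "\<forall>\<^sub>F n in sequentially. log_prob (?P B n) / ereal (b n) \<le> -\<infinity>"
      using bpos by eventually_elim (simp add: True log_prob_def)
    then have "limsup (\<lambda>n. log_prob (?P B n) / ereal (b n)) \<le> -\<infinity>" by (rule Limsup_bounded)
    then show ?thesis by simp
  next
    case False
    obtain x0 where x0: "x0 \<in> closure B" "\<And>y. y \<in> closure B \<Longrightarrow> dist 0 x0 \<le> dist 0 y"
      using distance_attains_inf[of "closure B" 0] False by auto
    define d where "d = \<bar>x0\<bar>"
    have d: "d \<le> \<bar>y\<bar>" if "y \<in> B" for y
      using x0(2)[of y] closure_subset that by (auto simp: d_def)
    \<comment> \<open>The maximiser of u d - u^2 v / 2, whose maximum d^2 / (2 v) is the rate at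
      distance \<open>d\<close>.\<close>
    define u where "u = d / v"
    have u0: "u \<ge> 0" using v by (simp add: u_def d_def)
    have ud: "u\<^sup>2 * v / 2 - u * d = - d\<^sup>2 / (2 * v)"
      using v by (simp add: u_def field_simps power2_eq_square)
    have "limsup (\<lambda>n. log_prob (?P B n) / ereal (b n)) \<le> ereal (- d\<^sup>2 / (2 * v))"
    proof (rule ereal_le_epsilon2)
      fix e :: real assume e: "e > 0"
      have "\<forall>\<^sub>F n in sequentially. ln 2 / (e / 2) < b n"
        using b by (simp add: filterlim_at_top_dense)
      then have "\<forall>\<^sub>F n in sequentially. log_prob (?P B n) / ereal (b n) \<le> ereal (- d\<^sup>2 / (2 * v) + e)"
        using bpos prob mgf[of u] mgf[of "-u"] Lle[of "e/2" u, OF half_gt_zero[OF e]]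
          Lle[of "e/2" "-u", OF half_gt_zero[OF e]]
      proof eventually_elim
        case (elim n)
        interpret prob_space "M n" by fact
        have bu: "u * b n \<ge> 0" using u0 elim by simp
        have "?P B n \<le> exp (- (u * b n) * d) * (expectation (\<lambda>\<omega>. exp (u * b n * X n \<omega>))
            + expectation (\<lambda>\<omega>. exp (- (u * b n) * X n \<omega>)))"
          using two_sided_chernoff[OF X B d bu] elim by simp
        also have "\<dots> = exp (- (u * b n) * d) * (exp (b n * L u n) + exp (b n * L (- u) n))"
          using elim by simp
        also have "\<dots> \<le> exp (- (u * b n) * d) * (exp (b n * (u\<^sup>2 * v / 2 + e / 2))
            + exp (b n * (u\<^sup>2 * v / 2 + e / 2)))"
          using elim by (intro mult_left_mono add_mono) auto
        also have "\<dots> = 2 * exp (b n * (u\<^sup>2 * v / 2 - u * d + e / 2))"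
          by (simp add: algebra_simps flip: exp_add)
        also have "\<dots> = exp (ln 2 + b n * (u\<^sup>2 * v / 2 - u * d + e / 2))"
          by (simp add: exp_add)
        also have "\<dots> \<le> exp (b n * (e / 2) + b n * (u\<^sup>2 * v / 2 - u * d + e / 2))"
          using elim e by (simp add: divide_less_eq)
        also have "\<dots> = exp (b n * (- d\<^sup>2 / (2 * v) + e))"
          unfolding ud by (simp add: algebra_simps)
        finally show ?case using elim by (subst log_prob_le_iff) auto
      qed
      then show "limsup (\<lambda>n. log_prob (?P B n) / ereal (b n)) \<le> ereal (- d\<^sup>2 / (2 * v)) + ereal e"
        by (simp add: Limsup_bounded)
    qed
    also have "\<dots> \<le> - (INF x \<in> closure B. ereal (x\<^sup>2 / (2 * v)))"
      using INF_lower[OF x0(1), of "\<lambda>x. ereal (x\<^sup>2 / (2 * v))"]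
      by (subst ereal_minus_le_minus[symmetric]) (simp add: d_def)
    finally show ?thesis .
  qed
  show "- (INF x \<in> interior B. ereal (x\<^sup>2 / (2 * v))) \<le> liminf (\<lambda>n. log_prob (?P B n) / ereal (b n))"
  proof (subst ereal_uminus_le_reorder, rule INF_greatest, subst ereal_uminus_le_reorder)
    fix x assume "x \<in> interior B"
    then obtain \<delta>0 where \<delta>0: "\<delta>0 > 0" "ball x \<delta>0 \<subseteq> B" by (meson mem_interior)
    \<comment> \<open>The limit u^2 v / 2 has slope u v, which this choice makes equal to
      \<open>x\<close>: the tilted law concentrates there.\<close>
    define u where "u = x / v"
    have "ereal (- x\<^sup>2 / (2 * v)) \<le> liminf (\<lambda>n. log_prob (?P B n) / ereal (b n))"
    proof (rule ereal_le_epsilon2)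
      fix e :: real assume e: "e > 0"
      \<comment> \<open>The second bound keeps the variation of the tilt over the ball, |u|
        \<open>\<delta>\<close>, below e/2; the 1 covers \<open>u = 0\<close>.\<close>
      define \<delta> where "\<delta> = min \<delta>0 (e / (2 * (\<bar>u\<bar> + 1)))"
      have \<delta>: "\<delta> > 0" using \<delta>0 e by (simp add: \<delta>_def)
      have B\<delta>: "y \<in> B" if "\<bar>y - x\<bar> < \<delta>" for y
        using \<delta>0 that by (auto simp: \<delta>_def dist_real_def subset_iff abs_minus_commute)
      have "\<bar>u\<bar> * \<delta> \<le> \<bar>u\<bar> * (e / (2 * (\<bar>u\<bar> + 1)))"
        unfolding \<delta>_def by (intro mult_left_mono) auto
      also have "\<dots> \<le> e / 2" using e by (simp add: field_simps)
      finally have u\<delta>: "\<bar>u\<bar> * \<delta> \<le> e / 2" .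
      \<comment> \<open>The minimiser of w^2 v / 2 - w \<open>\<delta>\<close>. The minimum is minus
        \<open>\<kappa>\<close>, so both tails fall short of the main term by the exponent
        \<open>b n * \<kappa>\<close> in the limit.\<close>
      define w where "w = \<delta> / v"
      have w: "w > 0" using \<delta> v by (simp add: w_def)
      define \<kappa> where "\<kappa> = \<delta>\<^sup>2 / (2 * v)"
      have \<kappa>: "\<kappa> > 0" using \<delta> v by (simp add: \<kappa>_def)
      \<comment> \<open>Main term and tail may each be off by \<open>\<eta>\<close>, which leaves a
        gap of at least \<open>\<kappa>\<close> / 3. The budget \<open>e\<close> is spent as e/2 on
        the ball, e/4 on \<open>\<eta>\<close> and e/4 on the factor 2 below.\<close>
      define \<eta> where "\<eta> = min (\<kappa> / 3) (e / 4)"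
      have \<eta>: "\<eta> > 0" using \<kappa> e by (simp add: \<eta>_def)
      have w1: "(u + w)\<^sup>2 * v / 2 - w * (x + \<delta>) = u\<^sup>2 * v / 2 - \<kappa>"
        and w2: "(u - w)\<^sup>2 * v / 2 + w * (x - \<delta>) = u\<^sup>2 * v / 2 - \<kappa>"
        using v by (simp_all add: w_def u_def \<kappa>_def field_simps power2_eq_square)
      have ux: "u\<^sup>2 * v / 2 - u * x = - x\<^sup>2 / (2 * v)"
        using v by (simp add: u_def field_simps power2_eq_square)
      \<comment> \<open>The first condition makes each tail at most a quarter of the main term, so
        that half of it survives; the second absorbs this half into the exponent.\<close>
      have "\<forall>\<^sub>F n in sequentially. ln 4 / (\<kappa> / 3) < b n" "\<forall>\<^sub>F n in sequentially. ln 2 / (e / 4) < b n"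
        using b by (simp_all add: filterlim_at_top_dense)
      then have "\<forall>\<^sub>F n in sequentially. ereal (- x\<^sup>2 / (2 * v) - e) \<le> log_prob (?P B n) / ereal (b n)"
        using bpos prob mgf[of u] mgf[of "u + w"] mgf[of "u - w"] Lge[OF \<eta>, of u]
          Lle[OF \<eta>, of "u + w"] Lle[OF \<eta>, of "u - w"]
      proof eventually_elim
        case (elim n)
        interpret prob_space "M n" by fact
        let ?b = "b n"
        have bn: "?b > 0" by fact
        have wb: "w * ?b \<ge> 0" using w bn by simp
        have eqs: "(u * ?b + w * ?b) * y = (u + w) * ?b * y" "(u * ?b - w * ?b) * y = (u - w) * ?b * y" for y
          by (simp_all add: algebra_simps)
        have "exp (u * ?b * x + \<bar>u * ?b\<bar> * \<delta>) * ?P B n \<ge>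
           expectation (\<lambda>\<omega>. exp (u * ?b * X n \<omega>))
          - exp (- (w * ?b) * (x + \<delta>)) * expectation (\<lambda>\<omega>. exp ((u * ?b + w * ?b) * X n \<omega>))
          - exp (w * ?b * (x - \<delta>)) * expectation (\<lambda>\<omega>. exp ((u * ?b - w * ?b) * X n \<omega>))"
          by (rule tilted_lower_bound[OF X B \<delta> B\<delta> wb]) (use elim in \<open>simp_all add: eqs\<close>)
        also have "expectation (\<lambda>\<omega>. exp (u * ?b * X n \<omega>)) = exp (?b * L u n)" using elim by simp
        also have "expectation (\<lambda>\<omega>. exp ((u * ?b + w * ?b) * X n \<omega>)) = exp (?b * L (u + w) n)"
          using elim by (simp add: eqs)
        also have "expectation (\<lambda>\<omega>. exp ((u * ?b - w * ?b) * X n \<omega>)) = exp (?b * L (u - w) n)"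
          using elim by (simp add: eqs)
        finally have low: "exp (?b * L u n) - exp (- (w * ?b) * (x + \<delta>)) * exp (?b * L (u + w) n)
          - exp (w * ?b * (x - \<delta>)) * exp (?b * L (u - w) n)
          \<le> exp (u * ?b * x + \<bar>u * ?b\<bar> * \<delta>) * ?P B n" .
        let ?E = "exp (?b * (u\<^sup>2 * v / 2 - \<eta>))"
        have ll: "\<kappa> - 2 * \<eta> \<ge> \<kappa> / 3" by (simp add: \<eta>_def min_def)
        have "ln 4 < ?b * (\<kappa> / 3)"
          using elim \<kappa> by (simp add: divide_less_eq)
        also have "\<dots> \<le> ?b * (\<kappa> - 2 * \<eta>)" using bn ll by (intro mult_left_mono) auto
        finally have "exp (ln 4) \<le> exp (?b * (\<kappa> - 2 * \<eta>))" by (simp only: exp_le_cancel_iff)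
        then have four: "4 * exp (?b * (u\<^sup>2 * v / 2 - \<kappa> + \<eta>)) \<le> ?E"
        proof -
          assume a: "exp (ln 4) \<le> exp (?b * (\<kappa> - 2 * \<eta>))"
          have "4 * exp (?b * (u\<^sup>2 * v / 2 - \<kappa> + \<eta>)) \<le> exp (?b * (\<kappa> - 2 * \<eta>)) * exp (?b * (u\<^sup>2 * v / 2 - \<kappa> + \<eta>))"
            using a by (intro mult_right_mono) auto
          also have "\<dots> = ?E" by (simp flip: exp_add add: algebra_simps)
          finally show ?thesis .
        qed
        have "?E \<le> exp (?b * L u n)" using elim bn by simp
        moreover have "exp (- (w * ?b) * (x + \<delta>)) * exp (?b * L (u + w) n) \<le> exp (?b * (u\<^sup>2 * v / 2 - \<kappa> + \<eta>))"
        proof -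
          have "- (w * ?b) * (x + \<delta>) + ?b * L (u + w) n \<le> - (w * ?b) * (x + \<delta>) + ?b * ((u + w)\<^sup>2 * v / 2 + \<eta>)"
            using elim bn by simp
          also have "\<dots> = ?b * (((u + w)\<^sup>2 * v / 2 - w * (x + \<delta>)) + \<eta>)" by (simp add: algebra_simps)
          finally show ?thesis unfolding w1 by (simp flip: exp_add)
        qed
        moreover have "exp (w * ?b * (x - \<delta>)) * exp (?b * L (u - w) n) \<le> exp (?b * (u\<^sup>2 * v / 2 - \<kappa> + \<eta>))"
        proof -
          have "w * ?b * (x - \<delta>) + ?b * L (u - w) n \<le> w * ?b * (x - \<delta>) + ?b * ((u - w)\<^sup>2 * v / 2 + \<eta>)"
            using elim bn by simp
          also have "\<dots> = ?b * (((u - w)\<^sup>2 * v / 2 + w * (x - \<delta>)) + \<eta>)" by (simp add: algebra_simps)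
          finally show ?thesis unfolding w2 by (simp flip: exp_add)
        qed
        ultimately have half: "?E / 2 \<le> exp (u * ?b * x + \<bar>u * ?b\<bar> * \<delta>) * ?P B n"
          using four low by linarith
        have "exp (?b * (- x\<^sup>2 / (2 * v) - e)) * exp (u * ?b * x + \<bar>u * ?b\<bar> * \<delta>)
          = exp (?b * (u\<^sup>2 * v / 2 - e + \<bar>u\<bar> * \<delta>))"
          unfolding ux[symmetric] using bn by (simp flip: exp_add add: algebra_simps abs_mult)
        also have "\<dots> \<le> exp (?b * (u\<^sup>2 * v / 2 - \<eta>) - ?b * (e / 4))"
        proof -
          have "?b * (u\<^sup>2 * v / 2 - e + \<bar>u\<bar> * \<delta>) \<le> ?b * (u\<^sup>2 * v / 2 - \<eta> - e / 4)"
            using bn u\<delta> by (intro mult_left_mono) (auto simp: \<eta>_def min_def)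
          then show ?thesis by (simp add: algebra_simps)
        qed
        also have "\<dots> \<le> exp (?b * (u\<^sup>2 * v / 2 - \<eta>) - ln 2)"
          using elim e by (simp add: divide_less_eq)
        also have "\<dots> = ?E / 2" by (simp add: exp_diff)
        also note half
        finally have "exp (u * ?b * x + \<bar>u * ?b\<bar> * \<delta>) * exp (?b * (- x\<^sup>2 / (2 * v) - e))
            \<le> exp (u * ?b * x + \<bar>u * ?b\<bar> * \<delta>) * ?P B n"
          by (simp only: mult.commute)
        then have "exp (?b * (- x\<^sup>2 / (2 * v) - e)) \<le> ?P B n"
          by (subst (asm) mult_le_cancel_left_pos) simp_all
        then show ?case using bn by (subst le_log_prob_iff) auto
      qed
      then have "ereal (- x\<^sup>2 / (2 * v) - e) \<le> liminf (\<lambda>n. log_prob (?P B n) / ereal (b n))"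
        by (rule Liminf_bounded)
      then have "ereal (- x\<^sup>2 / (2 * v) - e) + ereal e \<le> liminf (\<lambda>n. log_prob (?P B n) / ereal (b n)) + ereal e"
        by (rule add_right_mono)
      then show "ereal (- x\<^sup>2 / (2 * v)) \<le> liminf (\<lambda>n. log_prob (?P B n) / ereal (b n)) + ereal e"
        by simp
    qed
    then show "- ereal (x\<^sup>2 / (2 * v)) \<le> liminf (\<lambda>n. log_prob (?P B n) / ereal (b n))"
      by simp
  qed
qed (use X b in auto)

section \<open>Cumulants of logarithms of Beta variables\<close>

lemma trigamma_sums:
  assumes "x > (0::real)"
  shows "(\<lambda>k. inverse ((x + real k)\<^sup>2)) sums Polygamma 1 x"
  using Polygamma_LIMSEQ[of x 1] assms by (simp add: numeral_2_eq_2)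

lemma reciprocal_telescope_sums:
  assumes "x > (0::real)"
  shows "(\<lambda>k. inverse (x + real k) - inverse (x + real (Suc k))) sums inverse x"
proof -
  have "(\<lambda>k. inverse (x + real k)) \<longlonglongrightarrow> 0"
    by (intro tendsto_inverse_0_at_top filterlim_tendsto_add_at_top[OF tendsto_const] filterlim_real_sequentially)
  from telescope_sums'[OF this] show ?thesis by simp
qed

text \<open>With y = x + k, the terms 1/y^2 are at least the telescoping terms 1/(y (y + 1)), which
  sum to 1/x.\<close>

lemma trigamma_ge:
  assumes "x > (0::real)"
  shows "1 / x \<le> Polygamma 1 x"
proof -
  have "inverse x \<le> Polygamma 1 x"
  proof (rule sums_le[OF _ reciprocal_telescope_sums[OF assms] trigamma_sums[OF assms]])
    fix k show "inverse (x + real k) - inverse (x + real (Suc k)) \<le> inverse ((x + real k)\<^sup>2)"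
      using assms by (simp add: field_simps power2_eq_square add_pos_nonneg)
  qed
  then show ?thesis by (simp add: inverse_eq_divide)
qed

text \<open>The telescoping series dominates only after a shift, as 1/(y + 1)^2 <= 1/(y (y + 1)).
  This bounds the value at x + 1, and the recurrence returns the first term 1/x^2.\<close>

lemma trigamma_le:
  assumes "x > (0::real)"
  shows "Polygamma 1 x \<le> 1 / x + 1 / x\<^sup>2"
proof -
  have "Polygamma 1 (x + 1) \<le> inverse x"
  proof (rule sums_le[OF _ trigamma_sums reciprocal_telescope_sums[OF assms]])
    show "inverse ((x + 1 + real k)\<^sup>2) \<le> inverse (x + real k) - inverse (x + real (Suc k))" for k
    proof -
      define y where "y = x + real k"
      have "y > 0" using assms by (simp add: y_def)
      then have "inverse y - inverse (y + 1) = inverse (y * (y + 1))"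
        by (simp add: field_simps)
      moreover have "inverse ((y + 1)\<^sup>2) \<le> inverse (y * (y + 1))"
        using \<open>y > 0\<close> by (intro le_imp_inverse_le) (auto simp: power2_eq_square)
      ultimately have "inverse ((y + 1)\<^sup>2) \<le> inverse y - inverse (y + 1)" by simp
      then show ?thesis by (simp add: y_def add_ac)
    qed
  qed (use assms in simp)
  moreover have "Polygamma 1 (x + 1) = Polygamma 1 x - 1 / x\<^sup>2"
    using Polygamma_plus1[of x 1] assms by (simp add: numeral_2_eq_2)
  ultimately show ?thesis by (simp add: inverse_eq_divide)
qed

text \<open>The cumulant generating function of \<open>ln (Z\<^sup>c (1 - Z)\<^sup>d)\<close> for \<open>Z\<close> with
  distribution \<open>\<beta>(a, b)\<close>, and its first two derivatives.\<close>

definition beta_cgf :: "real \<Rightarrow> real \<Rightarrow> real \<Rightarrow> real \<Rightarrow> real \<Rightarrow> real" where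
  "beta_cgf a b c d t =
     ln_Gamma (a + c * t) + ln_Gamma (b + d * t) - ln_Gamma (a + b + (c + d) * t)
     - (ln_Gamma a + ln_Gamma b - ln_Gamma (a + b))"

definition beta_cgf' :: "real \<Rightarrow> real \<Rightarrow> real \<Rightarrow> real \<Rightarrow> real \<Rightarrow> real" where
  "beta_cgf' a b c d t =
     c * Digamma (a + c * t) + d * Digamma (b + d * t) - (c + d) * Digamma (a + b + (c + d) * t)"

definition beta_cgf'' :: "real \<Rightarrow> real \<Rightarrow> real \<Rightarrow> real \<Rightarrow> real \<Rightarrow> real" where
  "beta_cgf'' a b c d t =
     c\<^sup>2 * Polygamma 1 (a + c * t) + d\<^sup>2 * Polygamma 1 (b + d * t)
     - (c + d)\<^sup>2 * Polygamma 1 (a + b + (c + d) * t)"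

lemma beta_cgf_0 [simp]: "beta_cgf a b c d 0 = 0"
  by (simp add: beta_cgf_def)

lemma beta_cgf_deriv:
  assumes "a + c * t > 0" "b + d * t > 0"
  shows "(beta_cgf a b c d has_real_derivative beta_cgf' a b c d t) (at t)"
    and "(beta_cgf' a b c d has_real_derivative beta_cgf'' a b c d t) (at t)"
proof -
  have pos: "a + b + (c + d) * t > 0" using assms by (simp add: algebra_simps)
  have ni: "y \<notin> \<int>\<^sub>\<le>\<^sub>0" if "y > 0" for y :: real using that by (auto elim!: nonpos_Ints_cases)
  show "(beta_cgf a b c d has_real_derivative beta_cgf' a b c d t) (at t)"
    unfolding beta_cgf_def[abs_def] beta_cgf'_def using assms pos
    by (auto intro!: derivative_eq_intros simp: algebra_simps)
  have D: "((\<lambda>t. Digamma (u + e * t)) has_real_derivative e * Polygamma 1 (u + e * t)) (at t)"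
    if "u + e * t > 0" for u e :: real
  proof -
    have "((\<lambda>t. u + e * t) has_real_derivative e) (at t)"
      by (auto intro!: derivative_eq_intros)
    from DERIV_chain2[OF has_field_derivative_Polygamma[OF ni[OF that], of 0 UNIV] this]
    show ?thesis by (simp add: mult.commute)
  qed
  show "(beta_cgf' a b c d has_real_derivative beta_cgf'' a b c d t) (at t)"
    unfolding beta_cgf'_def[abs_def] beta_cgf''_def using assms pos
    by (auto intro!: derivative_eq_intros D simp: algebra_simps power2_eq_square)
qed

text \<open>Centring a variable subtracts \<open>t\<close> times its mean, the slope of the cumulant
  function at 0, so only the second-order remainder is left to estimate. The absolute values in the
  hypotheses keep the Gamma arguments positive on the whole interval from -|t| to |t|.\<close>

lemma beta_cgf_taylor:
  assumes "\<bar>c * t\<bar> < a" "\<bar>d * t\<bar> < b"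
  obtains \<xi> where "\<bar>\<xi>\<bar> \<le> \<bar>t\<bar>" "beta_cgf a b c d t - t * beta_cgf' a b c d 0 = t\<^sup>2 / 2 * beta_cgf'' a b c d \<xi>"
proof (cases "t = 0")
  case True
  then show ?thesis using that[of 0] by simp
next
  case False
  define diff where "diff m = (if m = 0 then beta_cgf a b c d else if m = 1 then beta_cgf' a b c d else beta_cgf'' a b c d)"
    for m :: nat
  have "\<forall>m x. m < 2 \<and> - \<bar>t\<bar> \<le> x \<and> x \<le> \<bar>t\<bar> \<longrightarrow> DERIV (diff m) x :> diff (Suc m) x"
  proof (intro allI impI, elim conjE)
    fix m :: nat and x assume m: "m < 2" and x: "- \<bar>t\<bar> \<le> x" "x \<le> \<bar>t\<bar>"
    have "\<bar>e * x\<bar> \<le> \<bar>e * t\<bar>" for e :: real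
      unfolding abs_mult using x by (intro mult_left_mono) auto
    then have "a + c * x > 0" "b + d * x > 0" using assms by (smt (verit))+
    then show "DERIV (diff m) x :> diff (Suc m) x"
      using m beta_cgf_deriv[of a c x b d] by (auto simp: diff_def less_2_cases_iff)
  qed
  then have "\<exists>\<xi>. (if t < 0 then t < \<xi> \<and> \<xi> < 0 else 0 < \<xi> \<and> \<xi> < t) \<and>
      diff 0 t = (\<Sum>m<2. diff m 0 / fact m * (t - 0) ^ m) + diff 2 \<xi> / fact 2 * (t - 0)\<^sup>2"
    using False by (intro Taylor[where a = "- \<bar>t\<bar>" and b = "\<bar>t\<bar>"]) auto
  then obtain \<xi> where \<xi>: "if t < 0 then t < \<xi> \<and> \<xi> < 0 else 0 < \<xi> \<and> \<xi> < t"
    "diff 0 t = (\<Sum>m<2. diff m 0 / fact m * (t - 0) ^ m) + diff 2 \<xi> / fact 2 * (t - 0)\<^sup>2"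
    by blast
  have "beta_cgf a b c d t = beta_cgf' a b c d 0 * t + beta_cgf'' a b c d \<xi> / 2 * t\<^sup>2"
    using \<xi>(2) by (simp add: diff_def numeral_2_eq_2)
  then show ?thesis using \<xi>(1) by (intro that[of \<xi>]) (auto split: if_splits)
qed

section \<open>Exponential moments of logarithms of Beta variables\<close>

lemma Beta_ratio_eq_exp:
  assumes "a > 0" "b > 0" "a + c * t > 0" "b + d * t > (0::real)"
  shows "Beta (a + c * t) (b + d * t) / Beta a b = exp (beta_cgf a b c d t)"
proof -
  have B: "Beta u w = exp (ln_Gamma u + ln_Gamma w - ln_Gamma (u + w))" if "u > 0" "w > 0" for u w :: real
    using that by (simp add: Beta_def Gamma_real_pos_exp exp_add exp_diff)
  have s: "a + c * t + (b + d * t) = a + b + (c + d) * t" by (simp add: algebra_simps)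
  show ?thesis
    unfolding B[OF assms(1,2)] B[OF assms(3,4)] s beta_cgf_def by (simp only: exp_diff)
qed

text \<open>The identity holds at the endpoints as well because \<open>0 powr y\<close> is 0, so no
  null set has to be removed.\<close>

lemma beta_density_times_powr:
  "beta_density a b x * (x powr u * (1 - x) powr w)
    = inverse (Beta a b) * (indicator {0..1} x *\<^sub>R (x powr (a + u - 1) * (1 - x) powr (b + w - 1)))"
proof -
  have "x powr (a + u - 1) = x powr (a - 1) * x powr u" "(1 - x) powr (b + w - 1) = (1 - x) powr (b - 1) * (1 - x) powr w"
    by (simp_all flip: powr_add add: algebra_simps)
  then show ?thesis
    by (cases "x = 0"; cases "x = 1") (auto simp: beta_density_def indicator_def divide_simps)
qed

lemma beta_density_nonneg:
  assumes "a > 0" "b > 0"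
  shows "beta_density a b x \<ge> 0"
  using assms by (auto simp: beta_density_def Beta_def)

lemma beta_distributed_AE:
  assumes Z: "distributed M lborel Z (\<lambda>x. ennreal (beta_density a b x))"
  shows "AE \<omega> in M. 0 < Z \<omega> \<and> Z \<omega> < 1"
proof -
  have [measurable]: "Z \<in> measurable M lborel" "(\<lambda>x. ennreal (beta_density a b x)) \<in> borel_measurable lborel"
    using Z by (auto simp only: distributed_def)
  have "AE x in distr M lborel Z. 0 < x \<and> x < 1"
    unfolding distributed_distr_eq_density[OF Z]
    by (subst AE_density) (auto simp: beta_density_def intro!: AE_I2)
  then show ?thesis by (rule AE_distrD[OF distributed_measurable[OF Z]])
qed

text \<open>A Beta density weighted by these powers is again a Beta density up to normalisation; the
  moment is the quotient of the normalising constants.\<close>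

lemma beta_moment:
  assumes Z: "distributed M lborel Z (\<lambda>x. ennreal (beta_density a b x))"
    and ab: "a > 0" "b > 0" and pos: "a + u > 0" "b + w > 0"
  shows "integrable M (\<lambda>\<omega>. Z \<omega> powr u * (1 - Z \<omega>) powr w)"
    and "(\<integral>\<omega>. Z \<omega> powr u * (1 - Z \<omega>) powr w \<partial>M) = Beta (a + u) (b + w) / Beta a b"
proof -
  let ?g = "\<lambda>x::real. x powr u * (1 - x) powr w"
  have g: "?g \<in> borel_measurable lborel" by measurable
  have int: "integrable lborel (\<lambda>x. beta_density a b x * ?g x)"
    unfolding beta_density_times_powr
    using integrable_Beta[OF pos] by (intro integrable_mult_right) (simp add: set_integrable_def)
  show "integrable M (\<lambda>\<omega>. Z \<omega> powr u * (1 - Z \<omega>) powr w)"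
    using int distributed_integrable[OF Z g beta_density_nonneg[OF ab]] by simp
  have "(\<integral>\<omega>. ?g (Z \<omega>) \<partial>M) = (\<integral>x. beta_density a b x * ?g x \<partial>lborel)"
    using distributed_integral[OF Z g beta_density_nonneg[OF ab]] by simp
  also have "\<dots> = inverse (Beta a b) * (LINT x:{0..1}|lborel. x powr (a + u - 1) * (1 - x) powr (b + w - 1))"
    unfolding beta_density_times_powr set_lebesgue_integral_def by simp
  also have "\<dots> = inverse (Beta a b) * Beta (a + u) (b + w)"
    using set_borel_integral_eq_integral(2)[OF integrable_Beta[OF pos]] has_integral_Beta_real[OF pos]
    by (simp add: integral_unique)
  finally show "(\<integral>\<omega>. ?g (Z \<omega>) \<partial>M) = Beta (a + u) (b + w) / Beta a b"
    by (simp add: divide_inverse mult.commute)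
qed

lemma beta_log_mgf:
  fixes a b t :: real and c d :: nat
  assumes Z: "distributed M lborel Z (\<lambda>x. ennreal (beta_density a b x))"
    and ab: "a > 0" "b > 0" and pos: "a + c * t > 0" "b + d * t > 0"
  shows "integrable M (\<lambda>\<omega>. exp (t * ln (Z \<omega> ^ c * (1 - Z \<omega>) ^ d)))"
    and "(\<integral>\<omega>. exp (t * ln (Z \<omega> ^ c * (1 - Z \<omega>) ^ d)) \<partial>M) = exp (beta_cgf a b c d t)"
proof -
  have [measurable]: "Z \<in> borel_measurable M" using distributed_measurable[OF Z] by simp
  have ae: "AE \<omega> in M. exp (t * ln (Z \<omega> ^ c * (1 - Z \<omega>) ^ d)) = Z \<omega> powr (c * t) * (1 - Z \<omega>) powr (d * t)"
    using beta_distributed_AE[OF Z]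
    by eventually_elim (simp add: powr_def ln_mult ln_realpow exp_add algebra_simps)
  show "integrable M (\<lambda>\<omega>. exp (t * ln (Z \<omega> ^ c * (1 - Z \<omega>) ^ d)))"
    by (subst integrable_cong_AE[OF _ _ ae]) (use beta_moment(1)[OF Z ab pos] in simp_all)
  have "(\<integral>\<omega>. exp (t * ln (Z \<omega> ^ c * (1 - Z \<omega>) ^ d)) \<partial>M) = (\<integral>\<omega>. Z \<omega> powr (c * t) * (1 - Z \<omega>) powr (d * t) \<partial>M)"
    by (rule integral_cong_AE[OF _ _ ae]) simp_all
  also have "\<dots> = exp (beta_cgf a b c d t)"
    using beta_moment(2)[OF Z ab pos] Beta_ratio_eq_exp[OF ab pos] by (simp add: mult.commute)
  finally show "(\<integral>\<omega>. exp (t * ln (Z \<omega> ^ c * (1 - Z \<omega>) ^ d)) \<partial>M) = exp (beta_cgf a b c d t)" .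
qed

text \<open>No differentiation under the integral: by \<open>e\<^sup>x \<ge> 1 + x\<close> the function
  \<open>t \<mapsto> e\<^bsup>K t\<^esup> - t E[Y]\<close> has a minimum at \<open>0\<close>.\<close>

lemma (in prob_space) expectation_eq_deriv_cgf:
  assumes Y: "Y \<in> borel_measurable M" and r: "r > 0"
    and int: "\<And>t. \<bar>t\<bar> < r \<Longrightarrow> integrable M (\<lambda>\<omega>. exp (t * Y \<omega>))"
    and mgf: "\<And>t. \<bar>t\<bar> < r \<Longrightarrow> expectation (\<lambda>\<omega>. exp (t * Y \<omega>)) = exp (K t)"
    and K: "K 0 = 0" "(K has_real_derivative D) (at 0)"
  shows "integrable M Y" and "expectation Y = D"
proof -
  define h where "h = r / 2"
  have h: "h > 0" "h < r" using r by (auto simp: h_def)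
  show iY: "integrable M Y"
  proof (rule Bochner_Integration.integrable_bound)
    show "integrable M (\<lambda>\<omega>. (exp (h * Y \<omega>) + exp (- h * Y \<omega>)) / h)"
      using int[of h] int[of "-h"] h by (intro integrable_divide_zero Bochner_Integration.integrable_add) auto
    show "AE \<omega> in M. norm (Y \<omega>) \<le> norm ((exp (h * Y \<omega>) + exp (- h * Y \<omega>)) / h)"
    proof (rule AE_I2)
      fix \<omega>
      have "h * \<bar>Y \<omega>\<bar> \<le> exp (h * \<bar>Y \<omega>\<bar>)" using exp_ge_add_one_self[of "h * \<bar>Y \<omega>\<bar>"] by linarith
      also have "\<dots> \<le> exp (h * Y \<omega>) + exp (- h * Y \<omega>)" by (cases "Y \<omega> \<ge> 0") auto
      finally show "norm (Y \<omega>) \<le> norm ((exp (h * Y \<omega>) + exp (- h * Y \<omega>)) / h)"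
        using h by (simp add: le_divide_eq mult.commute)
    qed
  qed (use Y in simp)
  define f where "f t = exp (K t) - t * expectation Y" for t
  have f: "(f has_real_derivative (D - expectation Y)) (at 0)"
    unfolding f_def[abs_def] using K by (auto intro!: derivative_eq_intros)
  have "D - expectation Y = 0"
  proof (rule DERIV_local_min[OF f r], rule, rule)
    fix t assume "\<bar>0 - t\<bar> < r"
    then have t: "\<bar>t\<bar> < r" by simp
    have "expectation (\<lambda>\<omega>. 1 + t * Y \<omega>) \<le> expectation (\<lambda>\<omega>. exp (t * Y \<omega>))"
      using iY int[OF t] by (intro integral_mono) (auto simp: exp_ge_add_one_self)
    then show "f 0 \<le> f t" using mgf[OF t] iY K by (simp add: f_def prob_space)
  qed
  then show "expectation Y = D" by simp
qed

text \<open>Independence makes the cumulant functions add up, and the mean of each summand is the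
  slope of its cumulant function at 0. Hence centring the sum acts on each cumulant function
  separately.\<close>

lemma (in prob_space) centered_sum_mgf:
  assumes fin: "finite J" and ind: "indep_vars (\<lambda>_. borel) Y J"
    and r: "\<And>x. x \<in> J \<Longrightarrow> r x > 0"
    and int: "\<And>x t. x \<in> J \<Longrightarrow> \<bar>t\<bar> < r x \<Longrightarrow> integrable M (\<lambda>\<omega>. exp (t * Y x \<omega>))"
    and mgf: "\<And>x t. x \<in> J \<Longrightarrow> \<bar>t\<bar> < r x \<Longrightarrow> expectation (\<lambda>\<omega>. exp (t * Y x \<omega>)) = exp (K x t)"
    and K: "\<And>x. x \<in> J \<Longrightarrow> K x 0 = 0" "\<And>x. x \<in> J \<Longrightarrow> (K x has_real_derivative D x) (at 0)"
    and S: "\<And>\<omega>. \<omega> \<in> space M \<Longrightarrow> S \<omega> = (\<Sum>x\<in>J. Y x \<omega>)"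
    and t: "\<And>x. x \<in> J \<Longrightarrow> \<bar>t\<bar> < r x"
  shows "integrable M (\<lambda>\<omega>. exp (t * (S \<omega> - expectation S)))"
    and "expectation (\<lambda>\<omega>. exp (t * (S \<omega> - expectation S))) = exp (\<Sum>x\<in>J. K x t - t * D x)"
proof -
  have Y: "Y x \<in> borel_measurable M" if "x \<in> J" for x
    using ind that by (auto simp: indep_vars_def)
  note mean = expectation_eq_deriv_cgf[OF Y r int mgf K]
  have "expectation S = expectation (\<lambda>\<omega>. \<Sum>x\<in>J. Y x \<omega>)"
    by (rule Bochner_Integration.integral_cong) (simp_all add: S)
  also have "\<dots> = (\<Sum>x\<in>J. D x)"
    by (subst Bochner_Integration.integral_sum) (auto simp: mean)
  finally have ES: "expectation S = (\<Sum>x\<in>J. D x)" .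
  have "indep_vars (\<lambda>_. borel) (\<lambda>x \<omega>. exp (t * Y x \<omega>)) J"
    by (rule indep_vars_compose2[OF ind]) measurable
  note prod = indep_vars_lebesgue_integral[OF fin this int[OF _ t]]
    indep_vars_integrable[OF fin this int[OF _ t]]
  have e: "exp (t * (S \<omega> - expectation S)) = exp (- t * (\<Sum>x\<in>J. D x)) * (\<Prod>x\<in>J. exp (t * Y x \<omega>))"
    if "\<omega> \<in> space M" for \<omega>
    unfolding exp_sum[OF fin, symmetric] exp_add[symmetric]
    by (simp add: S[OF that] ES right_diff_distrib flip: sum_distrib_left)
  show "integrable M (\<lambda>\<omega>. exp (t * (S \<omega> - expectation S)))"
    using prod by (subst Bochner_Integration.integrable_cong[OF refl e]) auto
  have "expectation (\<lambda>\<omega>. exp (t * (S \<omega> - expectation S)))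
      = exp (- t * (\<Sum>x\<in>J. D x)) * (\<Prod>x\<in>J. exp (K x t))"
    using prod by (subst Bochner_Integration.integral_cong[OF refl e]) (simp_all add: mgf t)
  also have "\<dots> = exp (\<Sum>x\<in>J. K x t - t * D x)"
    unfolding exp_sum[OF fin, symmetric] exp_add[symmetric]
    by (simp add: sum_subtractf flip: sum_distrib_left)
  finally show "expectation (\<lambda>\<omega>. exp (t * (S \<omega> - expectation S))) = exp (\<Sum>x\<in>J. K x t - t * D x)" .
qed

section \<open>Uniform estimates for the second derivative\<close>

lemma beta_cgf''_approx:
  assumes "a + c * t > 0" "b + d * t > 0"
  shows "\<bar>beta_cgf'' a b c d t - (c\<^sup>2 / (a + c * t) + d\<^sup>2 / (b + d * t) - (c + d)\<^sup>2 / (a + b + (c + d) * t))\<bar>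
    \<le> c\<^sup>2 / (a + c * t)\<^sup>2 + d\<^sup>2 / (b + d * t)\<^sup>2 + (c + d)\<^sup>2 / (a + b + (c + d) * t)\<^sup>2"
proof -
  have pos: "a + b + (c + d) * t > 0" using assms by (simp add: algebra_simps)
  have *: "e\<^sup>2 / y \<le> e\<^sup>2 * Polygamma 1 y \<and> e\<^sup>2 * Polygamma 1 y \<le> e\<^sup>2 / y + e\<^sup>2 / y\<^sup>2" if "y > 0" for e y :: real
    using mult_left_mono[OF trigamma_ge[OF that], of "e\<^sup>2"] mult_left_mono[OF trigamma_le[OF that], of "e\<^sup>2"]
    by (simp add: algebra_simps)
  have "0 \<le> c\<^sup>2 / (a + c * t)\<^sup>2" "0 \<le> d\<^sup>2 / (b + d * t)\<^sup>2" "0 \<le> (c + d)\<^sup>2 / (a + b + (c + d) * t)\<^sup>2"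
    by simp_all
  then show ?thesis
    using *[OF assms(1), of c] *[OF assms(2), of d] *[OF pos, of "c + d"]
    unfolding beta_cgf''_def by linarith
qed

text \<open>This exhibits the cancellation for the variables \<open>p\<close>: the combination
  vanishes when the exponents \<open>c\<close>, \<open>d\<close> are proportional to the shapes
  \<open>u\<close>, \<open>w\<close>, and is small when they nearly are.\<close>

lemma weighted_reciprocals:
  fixes c d u w :: real
  assumes "u > 0" "w > 0"
  shows "c\<^sup>2 / u + d\<^sup>2 / w - (c + d)\<^sup>2 / (u + w) = (c * w - d * u)\<^sup>2 / (u * w * (u + w))"
proof -
  have "u + w > 0" using assms by simp
  then show ?thesis using assms by (simp add: field_simps power2_eq_square)
qed

text \<open>Used for the quadratic trigamma errors: \<open>e\<close> is an exponent of order
  \<open>N\<close>, and \<open>y\<close> is at least a fixed fraction of a shape of order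
  \<open>q * N\<close>, so \<open>e / y\<close> is of order 1/q. \<open>B\<close> rounds the
  constant to a numeral.\<close>

lemma sq_div_sq_le:
  fixes e y \<alpha> N q \<kappa> :: real
  assumes "0 \<le> e" "e \<le> \<kappa> * N" "q > 0" "N > 0" "\<alpha> \<ge> q * N" "\<mu> > 0" "y \<ge> \<mu> * \<alpha>"
    and B: "(\<kappa> / \<mu>)\<^sup>2 \<le> B"
  shows "e\<^sup>2 / y\<^sup>2 \<le> B * (1 / q\<^sup>2)"
proof -
  have \<kappa>: "\<kappa> \<ge> 0" using assms by (smt (verit) mult_neg_pos)
  have qN: "q * N > 0" using assms by simp
  have "y \<ge> \<mu> * (q * N)" using assms by (smt (verit) mult_left_mono)
  moreover have "\<mu> * (q * N) > 0" using assms by simp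
  ultimately have "e / y \<le> \<kappa> * N / (\<mu> * (q * N))" using assms \<kappa> by (intro frac_le) auto
  also have "\<dots> = \<kappa> / \<mu> / q" using assms by simp
  finally have "e / y \<le> \<kappa> / \<mu> / q" .
  moreover have "y > 0" using \<open>y \<ge> \<mu> * (q * N)\<close> \<open>\<mu> * (q * N) > 0\<close> by linarith
  then have "e / y \<ge> 0" using assms by simp
  ultimately have "(e / y)\<^sup>2 \<le> (\<kappa> / \<mu> / q)\<^sup>2" by (intro power_mono)
  then have "e\<^sup>2 / y\<^sup>2 \<le> (\<kappa> / \<mu>)\<^sup>2 * (1 / q\<^sup>2)" by (simp add: power_divide power_mult_distrib)
  also have "\<dots> \<le> B * (1 / q\<^sup>2)" using B by (intro mult_right_mono) auto
  finally show ?thesis .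
qed

text \<open>The tilt moves each argument by a bounded fraction of \<open>\<alpha>\<close>, so all
  three stay comparable to \<open>\<alpha>\<close>. The trigamma errors contribute 16 + 2 + 4,
  rounded up to 28; the cancelled main part contributes 12, rounded up to 43.\<close>

lemma beta_cgf''_P_bound:
  fixes c d t \<alpha> N q j :: real
  assumes q: "q \<ge> 1" and N: "N \<ge> 1" and \<alpha>: "\<alpha> \<ge> q * N"
    and cd: "0 \<le> d" "d \<le> c" "c \<le> N" "c \<le> d + 1"
    and j: "0 \<le> j" "j \<le> q" and t: "N * \<bar>t\<bar> \<le> \<alpha> / 4"
  shows "\<bar>beta_cgf'' (\<alpha> - j / 2) \<alpha> c d t\<bar> \<le> 28 / q\<^sup>2 + 43 / (q * N)"
proof -
  have qN: "q * N \<ge> 1" "q * N \<ge> q" "q * N \<ge> N"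
    using q N mult_mono[of 1 q 1 N] by (simp_all add: mult_le_cancel_left1 mult_le_cancel_right1)
  have et: "\<bar>e * t\<bar> \<le> \<alpha> / 4" if "0 \<le> e" "e \<le> N" for e
    using mult_right_mono[OF that(2), of "\<bar>t\<bar>"] that t by (simp add: abs_mult)
  define u where "u = \<alpha> - j / 2 + c * t"
  define w where "w = \<alpha> + d * t"
  have u: "u \<ge> 1 / 4 * \<alpha>" and w: "w \<ge> 3 / 4 * \<alpha>"
    using et[of c] et[of d] cd j \<alpha> qN by (auto simp: u_def w_def)
  have a0: "\<alpha> > 0" using qN \<alpha> by linarith
  have pos: "u > 0" "w > 0" using u w a0 by auto
  have uw: "\<alpha> - j / 2 + \<alpha> + (c + d) * t = u + w" by (simp add: u_def w_def algebra_simps)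
  have uw': "u + w \<ge> 1 * \<alpha>" using u w by simp
  have "c\<^sup>2 / u\<^sup>2 \<le> 16 * (1 / q\<^sup>2)"
    by (rule sq_div_sq_le[OF _ _ _ _ \<alpha> _ u, where \<kappa> = 1]) (use cd q N in \<open>auto simp: power2_eq_square\<close>)
  moreover have "d\<^sup>2 / w\<^sup>2 \<le> 2 * (1 / q\<^sup>2)"
    by (rule sq_div_sq_le[OF _ _ _ _ \<alpha> _ w, where \<kappa> = 1]) (use cd q N in \<open>auto simp: power2_eq_square\<close>)
  moreover have "(c + d)\<^sup>2 / (u + w)\<^sup>2 \<le> 4 * (1 / q\<^sup>2)"
    by (rule sq_div_sq_le[OF _ _ _ _ \<alpha> _ uw', where \<kappa> = 2]) (use cd q N in \<open>auto simp: power2_eq_square\<close>)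
  ultimately have E: "c\<^sup>2 / u\<^sup>2 + d\<^sup>2 / w\<^sup>2 + (c + d)\<^sup>2 / (u + w)\<^sup>2 \<le> 28 * (1 / q\<^sup>2)"
    using zero_le_power2[of "1 / q"] unfolding power_divide one_power2 by linarith
  \<comment> \<open>The terms of order N \<open>\<alpha>\<close> cancel. What remains is at most 3/2
    \<open>\<alpha>\<close>, as \<open>c\<close> and \<open>d\<close> differ by at most 1 and the
    shapes by j/2 <= q/2. The quotient is thus of order \<open>\<alpha>\<close>^2 /
    \<open>\<alpha>\<close>^3.\<close>
  have cw: "c * w - d * u = (c - d) * \<alpha> + d * (j / 2)" by (simp add: u_def w_def algebra_simps)
  have "(c - d) * \<alpha> \<le> 1 * \<alpha>" using cd a0 by (intro mult_right_mono) auto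
  moreover have "d * (j / 2) \<le> N * (q / 2)" using cd j N by (intro mult_mono) auto
  moreover have "0 \<le> (c - d) * \<alpha>" "0 \<le> d * (j / 2)" using cd j a0 by auto
  ultimately have "0 \<le> c * w - d * u" "c * w - d * u \<le> 3/2 * \<alpha>" unfolding cw using \<alpha> by (simp_all add: mult.commute)
  then have num: "(c * w - d * u)\<^sup>2 \<le> (3/2 * \<alpha>)\<^sup>2" by (intro power_mono)
  have "(1/4 * \<alpha>) * (3/4 * \<alpha>) * (1 * \<alpha>) \<le> u * w * (u + w)"
    using u w uw' a0 pos by (intro mult_mono) auto
  then have "(c * w - d * u)\<^sup>2 / (u * w * (u + w)) \<le> (3/2 * \<alpha>)\<^sup>2 / ((1/4 * \<alpha>) * (3/4 * \<alpha>) * (1 * \<alpha>))"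
    using num a0 by (intro frac_le) auto
  also have "\<dots> = 12 / \<alpha>" using a0 by (simp add: power2_eq_square)
  also have "\<dots> \<le> 43 / (q * N)" using \<alpha> qN by (intro frac_le) auto
  finally have main: "(c * w - d * u)\<^sup>2 / (u * w * (u + w)) \<le> 43 / (q * N)" .
  have "0 \<le> (c * w - d * u)\<^sup>2 / (u * w * (u + w))" using pos by simp
  moreover have "28 * (1 / q\<^sup>2) = 28 / q\<^sup>2" by simp
  ultimately show ?thesis
    using beta_cgf''_approx[of "\<alpha> - j/2" c t \<alpha> d] pos main E weighted_reciprocals[OF pos, of c d]
    unfolding uw u_def[symmetric] w_def[symmetric] by linarith
qed

text \<open>As the exponent of 1 - r is 0, only c^2/u - c^2/w survives, and w - u = j/2 turns it
  into c^2 (j/2) / (u w). Replacing u w by \<open>\<alpha>\<close>^2 costs a relative error of order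
  q/\<open>\<alpha>\<close> from the shift by j/2 and of order \<open>\<epsilon>\<close> from the
  tilt.\<close>

lemma beta_cgf''_R_bound:
  fixes c t \<alpha> N q j \<epsilon> :: real
  assumes q: "q \<ge> 1" and N: "N \<ge> 1" and \<alpha>: "\<alpha> \<ge> q * N"
    and c: "0 \<le> c" "c \<le> N"
    and j: "0 < j" "j \<le> q" and t: "N * \<bar>t\<bar> \<le> \<epsilon> * \<alpha>" and \<epsilon>: "\<epsilon> \<le> 1 / 4"
  shows "\<bar>beta_cgf'' (\<alpha> - j / 2) (j / 2) c 0 t - c\<^sup>2 * (j / 2) / \<alpha>\<^sup>2\<bar> \<le> 18 / q\<^sup>2 + 2 / (q * N) + 12 * \<epsilon> / q"
proof -
  have qN: "q * N \<ge> 1" "q * N \<ge> q" "q * N \<ge> N"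
    using q N mult_mono[of 1 q 1 N] by (simp_all add: mult_le_cancel_left1 mult_le_cancel_right1)
  have a0: "\<alpha> > 0" using qN \<alpha> by linarith
  have e0: "\<epsilon> \<ge> 0" using t N a0 by (smt (verit) mult_nonneg_nonneg mult_neg_pos)
  define x where "x = c * t"
  have x: "\<bar>x\<bar> \<le> \<epsilon> * \<alpha>"
    using mult_right_mono[OF c(2), of "\<bar>t\<bar>"] c t by (simp add: abs_mult x_def)
  have "\<epsilon> * \<alpha> \<le> 1 / 4 * \<alpha>" using \<epsilon> a0 by (intro mult_right_mono) auto
  then have x4: "\<bar>x\<bar> \<le> \<alpha> / 4" using x by simp
  define u where "u = \<alpha> - j / 2 + x"
  define w where "w = \<alpha> + x"
  have u: "u \<ge> 1 / 4 * \<alpha>" and w: "w \<ge> 3 / 4 * \<alpha>"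
    unfolding u_def w_def using x4 j \<alpha> qN by linarith+
  have pos: "u > 0" "w > 0" using u w a0 by auto
  have "c\<^sup>2 / u\<^sup>2 \<le> 16 * (1 / q\<^sup>2)"
    by (rule sq_div_sq_le[OF _ _ _ _ \<alpha> _ u, where \<kappa> = 1]) (use c q N in \<open>auto simp: power2_eq_square\<close>)
  moreover have "c\<^sup>2 / w\<^sup>2 \<le> 2 * (1 / q\<^sup>2)"
    by (rule sq_div_sq_le[OF _ _ _ _ \<alpha> _ w, where \<kappa> = 1]) (use c q N in \<open>auto simp: power2_eq_square\<close>)
  ultimately have E: "c\<^sup>2 / u\<^sup>2 + c\<^sup>2 / w\<^sup>2 \<le> 18 * (1 / q\<^sup>2)"
    by linarith
  have D: "c\<^sup>2 / u - c\<^sup>2 / w - c\<^sup>2 * (j / 2) / \<alpha>\<^sup>2 = c\<^sup>2 * (j / 2) * ((\<alpha>\<^sup>2 - u * w) / (u * w * \<alpha>\<^sup>2))"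
  proof -
    have "c\<^sup>2 / u - c\<^sup>2 / w = c\<^sup>2 * (j / 2) / (u * w)"
      using pos by (simp add: field_simps) (simp add: u_def w_def algebra_simps)
    then have "c\<^sup>2 / u - c\<^sup>2 / w - c\<^sup>2 * (j / 2) / \<alpha>\<^sup>2 = c\<^sup>2 * (j / 2) * (1 / (u * w) - 1 / \<alpha>\<^sup>2)"
      by (simp add: algebra_simps)
    also have "1 / (u * w) - 1 / \<alpha>\<^sup>2 = (\<alpha>\<^sup>2 - u * w) / (u * w * \<alpha>\<^sup>2)"
      using pos a0 by (simp add: field_simps)
    finally show ?thesis .
  qed
  \<comment> \<open>The two summands separate the effect of the shift j/2 from that of the tilt
    x.\<close>
  have eq: "\<alpha>\<^sup>2 - u * w = (j / 2) * w - x * (2 * \<alpha> + x)"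
    by (simp add: u_def w_def algebra_simps power2_eq_square)
  have "\<bar>\<alpha>\<^sup>2 - u * w\<bar> \<le> (q / 2) * (5/4 * \<alpha>) + (\<epsilon> * \<alpha>) * (9/4 * \<alpha>)"
  proof -
    have "\<bar>(j / 2) * w\<bar> \<le> (q / 2) * (5/4 * \<alpha>)"
      unfolding abs_mult using j x4 a0 by (intro mult_mono) (auto simp: w_def)
    moreover have "\<bar>x * (2 * \<alpha> + x)\<bar> \<le> (\<epsilon> * \<alpha>) * (9/4 * \<alpha>)"
      unfolding abs_mult using x x4 a0 e0 by (intro mult_mono) auto
    ultimately show ?thesis unfolding eq by linarith
  qed
  moreover have "(1/4 * \<alpha>) * (3/4 * \<alpha>) * \<alpha>\<^sup>2 \<le> u * w * \<alpha>\<^sup>2"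
    using u w a0 pos by (intro mult_mono) auto
  ultimately have "\<bar>\<alpha>\<^sup>2 - u * w\<bar> / (u * w * \<alpha>\<^sup>2) \<le> ((q / 2) * (5/4 * \<alpha>) + (\<epsilon> * \<alpha>) * (9/4 * \<alpha>)) / ((1/4 * \<alpha>) * (3/4 * \<alpha>) * \<alpha>\<^sup>2)"
    using a0 by (intro frac_le) auto
  also have "\<dots> = (10 / 3 * q / \<alpha> + 12 * \<epsilon>) / \<alpha>\<^sup>2"
    using a0 by (simp add: field_simps power2_eq_square)
  finally have f: "\<bar>\<alpha>\<^sup>2 - u * w\<bar> / (u * w * \<alpha>\<^sup>2) \<le> (10 / 3 * q / \<alpha> + 12 * \<epsilon>) / \<alpha>\<^sup>2" .
  have "\<bar>c\<^sup>2 * (j / 2) * ((\<alpha>\<^sup>2 - u * w) / (u * w * \<alpha>\<^sup>2))\<bar> = c\<^sup>2 * (j / 2) * (\<bar>\<alpha>\<^sup>2 - u * w\<bar> / (u * w * \<alpha>\<^sup>2))"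
    using pos j a0 by (simp add: abs_mult)
  also have "\<dots> \<le> c\<^sup>2 * (q / 2) * ((10 / 3 * q / \<alpha> + 12 * \<epsilon>) / \<alpha>\<^sup>2)"
    using f j q pos a0 by (intro mult_mono) auto
  also have "\<dots> = (c\<^sup>2 / \<alpha>\<^sup>2) * ((q / 2) * (10 / 3 * q / \<alpha> + 12 * \<epsilon>))" by (simp add: mult_ac)
  also have "\<dots> \<le> (1 * (1 / q\<^sup>2)) * ((q / 2) * (10 / 3 * q / (q * N) + 12 * \<epsilon>))"
  proof (intro mult_mono add_right_mono)
    show "c\<^sup>2 / \<alpha>\<^sup>2 \<le> 1 * (1 / q\<^sup>2)"
      by (rule sq_div_sq_le[OF _ _ _ _ \<alpha>, where \<kappa> = 1 and \<mu> = 1]) (use c q N in \<open>auto simp: power2_eq_square\<close>)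
    show "10 / 3 * q / \<alpha> \<le> 10 / 3 * q / (q * N)" using \<alpha> qN q by (intro frac_le) auto
  qed (use q a0 e0 in auto)
  also have "\<dots> = (5/3) / (q * N) + 6 * \<epsilon> / q" using q N by (simp add: field_simps power2_eq_square)
  also have "\<dots> \<le> 2 / (q * N) + 12 * \<epsilon> / q"
    using q N e0 by (intro add_mono divide_right_mono) auto
  finally have main: "\<bar>c\<^sup>2 / u - c\<^sup>2 / w - c\<^sup>2 * (j / 2) / \<alpha>\<^sup>2\<bar> \<le> 2 / (q * N) + 12 * \<epsilon> / q" unfolding D .
  have "\<bar>beta_cgf'' (\<alpha> - j / 2) (j / 2) c 0 t - (c\<^sup>2 / u - c\<^sup>2 / w)\<bar> \<le> c\<^sup>2 / u\<^sup>2 + c\<^sup>2 / w\<^sup>2"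
    using beta_cgf''_approx[of "\<alpha> - j/2" c t "j/2" 0] pos j by (simp add: u_def w_def x_def)
  then show ?thesis using main E by simp
qed

section \<open>The limiting variance\<close>

text \<open>On each cell the error is at most \<open>h\<close> times the drop of \<open>g\<close>,
  and the drops telescope. Monotonicity alone is used, which admits the jump that the integrand has
  at y = 1 when t = 1.\<close>

lemma antimono_Riemann_sum:
  fixes g :: "real \<Rightarrow> real"
  assumes anti: "\<And>x y. 0 \<le> x \<Longrightarrow> x \<le> y \<Longrightarrow> y \<le> t \<Longrightarrow> g y \<le> g x"
    and int: "g integrable_on {0..t}" and h: "h > 0" and K: "real K * h \<le> t"
  shows "integral {0..real K * h} g \<le> h * (\<Sum>i<K. g (real i * h))"
    and "h * (\<Sum>i<K. g (real i * h)) \<le> integral {0..real K * h} g + h * (g 0 - g (real K * h))"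
proof -
  have "integral {0..real K * h} g \<le> h * (\<Sum>i<K. g (real i * h)) \<and>
    h * (\<Sum>i<K. g (real i * h)) \<le> integral {0..real K * h} g + h * (g 0 - g (real K * h))"
    using K
  proof (induction K)
    case 0
    then show ?case by simp
  next
    case (Suc K)
    define l where "l = real K * h"
    have r: "real (Suc K) * h = l + h" by (simp add: l_def algebra_simps)
    have l: "0 \<le> l" "l + h \<le> t" using Suc.prems h r by (simp_all add: l_def)
    have il: "g integrable_on {0..l + h}" "g integrable_on {l..l + h}"
      using l h by (auto intro!: integrable_on_subinterval[OF int])
    have "integral {0..l + h} g = integral {0..l} g + integral {l..l + h} g"
      using l h il by (intro Henstock_Kurzweil_Integration.integral_combine[symmetric]) auto
    moreover have "integral {l..l + h} g \<le> integral {l..l + h} (\<lambda>_. g l)"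
      using l il by (intro integral_le) (auto intro: anti)
    moreover have "integral {l..l + h} (\<lambda>_. g (l + h)) \<le> integral {l..l + h} g"
      using l il by (intro integral_le) (auto intro: anti)
    moreover have "integral {0..l} g \<le> h * (\<Sum>i<K. g (real i * h)) \<and>
      h * (\<Sum>i<K. g (real i * h)) \<le> integral {0..l} g + h * (g 0 - g l)"
      using Suc l h by (simp add: l_def)
    ultimately show ?case
      using h unfolding r sum.lessThan_Suc l_def[symmetric] by (simp add: algebra_simps)
  qed
  then show "integral {0..real K * h} g \<le> h * (\<Sum>i<K. g (real i * h))"
    and "h * (\<Sum>i<K. g (real i * h)) \<le> integral {0..real K * h} g + h * (g 0 - g (real K * h))"
    by auto
qed

text \<open>The true growth is logarithmic, but any o(m) serves, and the square root makes the
  induction a telescoping estimate.\<close>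

lemma sum_reciprocals_le: "(\<Sum>l\<in>{1..m}. 1 / real l) \<le> 2 * sqrt (real m)"
proof (induction m)
  case (Suc m)
  define x where "x = sqrt (real m)"
  define y where "y = sqrt (real (Suc m))"
  have xy: "0 \<le> x" "x \<le> y" "1 \<le> y" "y\<^sup>2 = x\<^sup>2 + 1" "y\<^sup>2 = real (Suc m)"
    by (simp_all add: x_def y_def)
  have "1 / y\<^sup>2 \<le> 1 / y" using xy(3) self_le_power[of y 2] by (intro frac_le) auto
  also have "1 / y \<le> 2 * (y - x)"
  proof -
    have "1 = (y - x) * (y + x)" using xy by (simp add: algebra_simps power2_eq_square)
    also have "\<dots> \<le> (y - x) * (2 * y)" using xy by (intro mult_left_mono) auto
    finally show ?thesis using xy by (simp add: field_simps)
  qed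
  finally have "1 / real (Suc m) \<le> 2 * (y - x)" unfolding xy(5) .
  moreover have "sqrt (1 + real m) = y" by (simp add: y_def)
  ultimately show ?case using Suc by (simp add: x_def[symmetric])
qed simp

text \<open>This sums the errors of order 1/N i over the rows, including the last ones, where a
  single such error need not be small.\<close>

lemma sum_shifted_reciprocals_le:
  assumes "K \<le> m"
  shows "(\<Sum>i\<in>{1..K}. 1 / (real m - real i + 1)) \<le> 2 * sqrt (real m)"
proof -
  have "(\<Sum>i\<in>{1..K}. 1 / (real m - real i + 1)) \<le> (\<Sum>i\<in>{1..m}. 1 / (real m - real i + 1))"
    using assms by (intro sum_mono2) auto
  also have "\<dots> = (\<Sum>l\<in>{1..m}. 1 / real l)"
    by (rule sum.reindex_bij_witness[of _ "\<lambda>l. m + 1 - l" "\<lambda>i. m + 1 - i"]) auto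
  also note sum_reciprocals_le
  finally show ?thesis .
qed

section \<open>Monotonicity, integrability and positivity of the limiting integrand\<close>

lemma limit_ratio_antimono:
  fixes t x y :: real
  assumes "t \<le> 1" "x \<le> y" "y \<le> t"
  shows "(t - y) / (1 - y) \<le> (t - x) / (1 - x)"
proof (cases "y = 1")
  \<comment> \<open>Here t = 1 as well, and the left side is 0 by the convention for division by
    zero.\<close>
  case True
  then show ?thesis using assms by simp
next
  case False
  then have "y < 1" "x < 1" using assms by auto
  moreover have "(t - x) * (1 - y) - (t - y) * (1 - x) = (1 - t) * (y - x)" by (simp add: algebra_simps)
  moreover have "(1 - t) * (y - x) \<ge> 0" using assms by simp
  ultimately show ?thesis
    by (subst frac_le_eq) (auto intro!: divide_nonpos_pos)
qed

lemma limit_ratio_bounds: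
  fixes t y :: real
  assumes "t \<le> 1" "0 \<le> y" "y \<le> t"
  shows "0 \<le> (t - y) / (1 - y)" "(t - y) / (1 - y) \<le> t"
  using assms limit_ratio_antimono[of t 0 y] by auto

lemma limit_integrand_antimono:
  fixes t x y :: real
  assumes "t \<le> 1" "0 \<le> x" "x \<le> y" "y \<le> t"
  shows "((t - y) / (1 - y))\<^sup>2 \<le> ((t - x) / (1 - x))\<^sup>2"
  using assms by (intro power_mono limit_ratio_antimono limit_ratio_bounds) auto

lemma limit_integrand_integrable:
  fixes t :: real
  assumes "0 < t" "t \<le> 1"
  shows "(\<lambda>y. ((t - y) / (1 - y))\<^sup>2) integrable_on {0..t}"
proof (cases "t = 1")
  case True
  have "(\<lambda>_::real. 1::real) integrable_on {0..1}" by (rule integrable_const_ivl)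
  then show ?thesis unfolding True
    by (rule integrable_spike[of _ _ "{1}"]) auto
next
  case False
  then show ?thesis using assms
    by (intro integrable_continuous_real continuous_intros) auto
qed

lemma limit_integral_pos:
  fixes t :: real
  assumes "0 < t" "t \<le> 1"
  shows "integral {0..t} (\<lambda>y. ((t - y) / (1 - y))\<^sup>2) > 0"
proof -
  let ?g = "\<lambda>y. ((t - y) / (1 - y))\<^sup>2"
  have int: "?g integrable_on {0..t}" by (rule limit_integrand_integrable[OF assms])
  have i2: "?g integrable_on {0..t/2}" using assms by (auto intro!: integrable_on_subinterval[OF int])
  have "0 < t / 2 * ?g (t / 2)" using assms by simp
  also have "\<dots> = integral {0..t/2} (\<lambda>_. ?g (t / 2))" using assms by simp
  also have "\<dots> \<le> integral {0..t/2} ?g"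
    using assms i2 by (intro integral_le limit_integrand_antimono) auto
  also have "\<dots> \<le> integral {0..t} ?g"
    using assms i2 int by (intro integral_subset_le) auto
  finally show ?thesis .
qed

text \<open>The rows are sample points of mesh 1/(2n), and numerator and denominator of the row
  ratio differ from those of the integrand by O(1) after scaling by 2n. The row error is therefore
  O(1/(2n - i + 1)), which is summable to O(sqrt n).\<close>

lemma ratio_sq_sum_approx:
  fixes t :: real and n k :: nat
  assumes n: "n \<ge> 1" and t: "0 < t" "t \<le> 1" and k: "k = nat \<lfloor>real n * t\<rfloor>"
  shows "\<bar>(\<Sum>i\<in>{1..2*k}. (real (k - i div 2) / ((2 * real n - real i + 2) / 2))\<^sup>2) / (2 * real n)
      - integral {0..t} (\<lambda>y. ((t - y) / (1 - y))\<^sup>2)\<bar>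
    \<le> (16 * sqrt (2 * real n) + 3) / (2 * real n)"
proof -
  let ?g = "\<lambda>y. ((t - y) / (1 - y))\<^sup>2"
  define m where "m = 2 * real n"
  define h where "h = 1 / m"
  have m: "m > 0" "m \<ge> 2" "h > 0" using n by (auto simp: m_def h_def)
  have "real n * t \<ge> 0" using t by simp
  then have k1: "real k \<le> real n * t" "real n * t < real k + 1" unfolding k by linarith+
  have nt: "real n * t \<le> real n" using t by (simp add: mult_left_le)
  then have kn: "k \<le> n" using k1 by linarith
  define e where "e i = real (k - i div 2) / ((m - real i + 2) / 2)" for i
  \<comment> \<open>Sampling at the left end of the cell keeps 1 - y positive even in row i =
    2n.\<close>
  define z where "z i = (t - real (i - 1) * h) / (1 - real (i - 1) * h)" for i :: nat
  have key: "\<bar>(e i)\<^sup>2 - (z i)\<^sup>2\<bar> \<le> 8 * (1 / (m - real i + 1))" if i: "i \<in> {1..2*k}" for i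
  proof -
    have im: "real i \<le> m" using i kn by (auto simp: m_def)
    have il: "1 \<le> i" "i \<le> 2 * k" using i by auto
    define D where "D = m - real i + 1"
    have D: "D \<ge> 1" using im by (simp add: D_def)
    define f where "f = 2 * real (k - i div 2)"
    have "2 * (k - i div 2) \<le> 2 * k - i + 1" "2 * k - i \<le> 2 * (k - i div 2)" using il by presburger+
    then have f1: "f \<le> 2 * real k - real i + 1" "2 * real k - real i \<le> f"
      unfolding f_def using il by linarith+
    have tm: "t * m = 2 * (real n * t)" by (simp add: m_def)
    \<comment> \<open>In the scaling by \<open>m\<close>, the value \<open>z i\<close> is
      \<open>w / D\<close> and \<open>e i\<close> is \<open>f / (D + 1)\<close>. The floor in
      \<open>k\<close> and the halving of \<open>i\<close> together put \<open>f\<close> between w -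
      3 and w.\<close>
    define w where "w = t * m - real i + 1"
    have f2: "f \<le> w" "w - 3 \<le> f" unfolding w_def using f1 k1 tm by linarith+
    have f0: "0 \<le> f" by (simp add: f_def)
    have wD: "w \<le> D" using nt tm m_def unfolding w_def D_def by linarith
    have ee: "e i = f / (D + 1)" by (simp add: e_def f_def D_def add_ac mult.commute)
    have ri: "real (i - 1) = real i - 1" using il by auto
    have zz: "z i = w / D"
    proof -
      have "m * (t - real (i - 1) * h) = w" "m * (1 - real (i - 1) * h) = D"
        using m unfolding w_def D_def h_def ri by (simp_all add: field_simps)
      then show ?thesis using m unfolding z_def by (metis less_irrefl mult_divide_mult_cancel_left)
    qed
    have e01: "0 \<le> e i" "e i \<le> 1" using f0 f2 wD D by (auto simp: ee)
    have z01: "0 \<le> z i" "z i \<le> 1" using f0 f2 wD D by (auto simp: zz)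
    have "\<bar>e i - z i\<bar> \<le> 4 * (1 / D)"
    proof -
      \<comment> \<open>The 4 below is 3 for w - f plus 1 for w / D. It becomes 8 for the squares,
        since e i + z i <= 2.\<close>
      have "z i - e i = (w - f + w / D) / (D + 1)" using D by (simp add: ee zz field_simps)
      also have "\<dots> \<le> 4 / D" 
      proof (rule frac_le)
        show "w - f + w / D \<le> 4" using z01(2) f2 unfolding zz by linarith
      qed (use D in auto)
      finally have 1: "z i - e i \<le> 4 / D" .
      have "e i \<le> f / D" unfolding ee using f0 D by (intro divide_left_mono) auto
      also have "\<dots> \<le> z i" unfolding zz using f2 D by (intro divide_right_mono) auto
      finally show ?thesis using 1 D by (simp add: abs_le_iff)
    qed
    moreover have "\<bar>(e i)\<^sup>2 - (z i)\<^sup>2\<bar> = \<bar>e i - z i\<bar> * (e i + z i)"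
      using e01 z01 by (simp add: power2_eq_square square_diff_square_factored abs_mult)
    moreover have "\<bar>e i - z i\<bar> * (e i + z i) \<le> \<bar>e i - z i\<bar> * 2"
      using e01 z01 by (intro mult_left_mono) auto
    ultimately show ?thesis by (simp add: D_def)
  qed
  have "\<bar>(\<Sum>i\<in>{1..2*k}. (e i)\<^sup>2) - (\<Sum>i\<in>{1..2*k}. (z i)\<^sup>2)\<bar> \<le> (\<Sum>i\<in>{1..2*k}. 8 * (1 / (m - real i + 1)))"
    unfolding sum_subtractf[symmetric] using key by (intro sum_abs[THEN order_trans] sum_mono)
  also have "\<dots> \<le> 8 * (2 * sqrt m)"
    using sum_shifted_reciprocals_le[of "2 * k" "2 * n"] kn unfolding sum_distrib_left[symmetric] by (simp add: m_def)
  finally have 1: "\<bar>(\<Sum>i\<in>{1..2*k}. (e i)\<^sup>2) - (\<Sum>i\<in>{1..2*k}. (z i)\<^sup>2)\<bar> \<le> 16 * sqrt m" by simp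
  have zsum: "(\<Sum>i\<in>{1..2*k}. (z i)\<^sup>2) = (\<Sum>i<2*k. ?g (real i * h))"
    by (rule sum.reindex_bij_witness[of _ Suc "\<lambda>i. i - 1"]) (auto simp: z_def)
  \<comment> \<open>The Riemann sum stops at T, short of \<open>t\<close> by at most 2 h. As the
    integrand lies between 0 and 1, the missing piece and the Riemann error together give 3
    h.\<close>
  define T where "T = real (2 * k) * h"
  have T: "0 \<le> T" "T \<le> t" "t - T \<le> 2 * h"
  proof -
    have tm: "t = (2 * (real n * t)) * h" using m by (simp add: h_def m_def)
    have tT: "t - T = (2 * (real n * t) - real (2 * k)) * h"
      unfolding T_def by (subst tm) (simp add: left_diff_distrib)
    have "0 \<le> t - T" unfolding tT using k1 m by (intro mult_nonneg_nonneg) auto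
    then show "T \<le> t" by simp
    show "t - T \<le> 2 * h" unfolding tT using k1 m by (intro mult_right_mono) auto
    show "0 \<le> T" using m by (simp add: T_def)
  qed
  have int: "?g integrable_on {0..t}" by (rule limit_integrand_integrable[OF t])
  have g01: "0 \<le> ?g y" "?g y \<le> 1" if "0 \<le> y" "y \<le> t" for y
    using limit_ratio_bounds[OF t(2) that] t by (auto intro!: power_le_one)
  have R: "integral {0..T} ?g \<le> h * (\<Sum>i<2*k. ?g (real i * h))"
    "h * (\<Sum>i<2*k. ?g (real i * h)) \<le> integral {0..T} ?g + h * (?g 0 - ?g T)"
    unfolding T_def
    by (rule antimono_Riemann_sum[where t = t]; use limit_integrand_antimono[OF t(2)] int m T in \<open>simp add: T_def\<close>)+
  have "integral {0..t} ?g = integral {0..T} ?g + integral {T..t} ?g"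
    using T int by (intro Henstock_Kurzweil_Integration.integral_combine[symmetric]) auto
  moreover have "0 \<le> integral {T..t} ?g"
    using T by (intro integral_nonneg integrable_on_subinterval[OF int]) auto
  moreover have "integral {T..t} ?g \<le> integral {T..t} (\<lambda>_. 1)"
    using T g01 by (intro integral_le integrable_on_subinterval[OF int]) auto
  moreover have "h * (?g 0 - ?g T) \<le> h * 1"
  proof (rule mult_left_mono)
    show "?g 0 - ?g T \<le> 1" using g01(2)[of 0] g01(1)[of T] T t by linarith
  qed (use m in simp)
  moreover have "integral {T..t} (\<lambda>_. 1 :: real) = t - T" using T by simp
  ultimately have 2: "\<bar>h * (\<Sum>i\<in>{1..2*k}. (z i)\<^sup>2) - integral {0..t} ?g\<bar> \<le> 3 * h"
    using R T(3) m(3) unfolding zsum abs_le_iff by linarith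
  have "\<bar>h * (\<Sum>i\<in>{1..2*k}. (e i)\<^sup>2) - h * (\<Sum>i\<in>{1..2*k}. (z i)\<^sup>2)\<bar> \<le> h * (16 * sqrt m)"
    using mult_left_mono[OF 1, of h] m by (simp add: abs_mult flip: right_diff_distrib)
  with 2 have "\<bar>h * (\<Sum>i\<in>{1..2*k}. (e i)\<^sup>2) - integral {0..t} ?g\<bar> \<le> h * (16 * sqrt m) + 3 * h" by linarith
  then show ?thesis unfolding e_def m_def[symmetric] by (simp add: h_def add_divide_distrib)
qed

section \<open>The cumulant generating function of \<open>H\<close>\<close>

lemma sum_pair_odd_even:
  fixes f :: "nat \<Rightarrow> 'b::comm_monoid_add"
  shows "(\<Sum>i\<in>{1..k}. f (2 * i) + f (2 * i - 1)) = (\<Sum>i\<in>{1..2 * k}. f i)"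
  by (induction k) (simp_all add: add_ac)

lemma sum_real_lt: "(\<Sum>j\<in>{1..<m}. real j / 2) = real m * (real m - 1) / 4"
proof (induction m)
  case (Suc m)
  then show ?case by (cases m) (simp_all add: field_simps)
qed simp

lemma sum_Times_fst:
  fixes f :: "'b \<Rightarrow> real"
  shows "(\<Sum>p\<in>A \<times> B. f (fst p)) = (\<Sum>i\<in>A. real (card B) * f i)"
  using sum.cartesian_product[of "\<lambda>x y. f x" B A] by (simp add: split_beta)

text \<open>Here \<open>i\<close> is the index of the array itself, so that \<open>2 i\<close> and \<open>2 i - 1\<close> in the definition of
  \<open>H\<close> are treated alike: the exponents of \<open>r\<^bsub>i,j\<^esub>\<close> and \<open>1 - p\<^bsub>i,j\<^esub>\<close> are \<open>k - i div 2\<close>, that of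
  \<open>p\<^bsub>i,j\<^esub>\<close> is \<open>k - (i - 1) div 2\<close>.\<close>

lemma (in prob_space) H_mgf:
  fixes P R :: "nat \<Rightarrow> nat \<Rightarrow> 'a \<Rightarrow> real" and s t \<theta> \<epsilon> :: real and n q :: nat
  assumes n: "n \<ge> 1" and q: "q \<ge> 1" and arr: "beta_array M n q P R"
    and s: "0 < s" "s \<le> 1" and t: "0 < t" "t \<le> 1"
    and \<theta>: "\<bar>\<theta>\<bar> \<le> \<epsilon> * real q" and \<epsilon>: "\<epsilon> \<le> 1 / 4"
    and k: "k = nat \<lfloor>real n * t\<rfloor>" and m: "m = nat \<lfloor>real q * s\<rfloor>"
  defines "N \<equiv> \<lambda>i::nat. (2 * real n - real i + 2) / 2"
  obtains \<Lambda> where "H n q P R s t \<in> borel_measurable M"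
    and "integrable M (\<lambda>\<omega>. exp (\<theta> * (H n q P R s t \<omega> - expectation (H n q P R s t))))"
    and "expectation (\<lambda>\<omega>. exp (\<theta> * (H n q P R s t \<omega> - expectation (H n q P R s t)))) = exp \<Lambda>"
    and "\<bar>\<Lambda> - \<theta>\<^sup>2 / 2 * ((\<Sum>i\<in>{1..2*k}. (real (k - i div 2) / N i)\<^sup>2) * (real m * (real m - 1) / 4) / (real q + 1)\<^sup>2)\<bar>
      \<le> \<theta>\<^sup>2 / 2 * (\<Sum>i\<in>{1..2*k}. 46 / q + 45 / N i + 12 * \<epsilon>)"
proof -
  define c d where "c i = k - (i - 1) div 2" and "d i = k - i div 2" for i
  define \<alpha> where "\<alpha> i = (real q + 1) / 2 * (2 * real n - real i + 2)" for i :: nat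
  define A1 A2 where "A1 = {1..2*k} \<times> {0..<m}" and "A2 = {1..2*k} \<times> {1..<m}"
  \<comment> \<open>The disjoint sum matches the index set in \<open>beta_array\<close>, so
    independence restricts to \<open>J\<close>. Setting \<open>D\<close> to 0 on the right summand
    brings the \<open>r\<close> into the same form as the \<open>p\<close>.\<close>
  define J where "J = A1 <+> A2"
  define Z where "Z = case_sum (\<lambda>(i, j). P i j) (\<lambda>(i, j). R i j)"
  define a where "a = case_sum (\<lambda>(i, j). \<alpha> i - real j / 2) (\<lambda>(i, j). \<alpha> i - real j / 2)"
  define b where "b = case_sum (\<lambda>(i, j::nat). \<alpha> i) (\<lambda>(i::nat, j). real j / 2)"
  define C where "C = case_sum (\<lambda>(i, j::nat). c i) (\<lambda>(i, j::nat). d i)"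
  define D where "D = case_sum (\<lambda>(i, j::nat). d i) (\<lambda>(i::nat, j::nat). 0)"
  define Y where "Y x \<omega> = ln (Z x \<omega> ^ C x * (1 - Z x \<omega>) ^ D x)" for x \<omega>
  have kn: "k \<le> n"
  proof -
    have "real n * t \<le> real n" using t by (simp add: mult_left_le)
    then show ?thesis unfolding k by linarith
  qed
  have mq: "m \<le> q"
  proof -
    have "real q * s \<le> real q" using s by (simp add: mult_left_le)
    then show ?thesis unfolding m by linarith
  qed
  have \<epsilon>0: "\<epsilon> \<ge> 0" 
  proof -
    have "0 \<le> \<epsilon> * real q" using \<theta> by linarith
    then show ?thesis using q by (simp add: zero_le_mult_iff)
  qed
  have q1: "real q \<ge> 1" using q by simp
  have iN: "N i \<ge> 1" "\<alpha> i \<ge> real q * N i" "\<alpha> i = (real q + 1) * N i" "c i \<le> N i" "d i \<le> c i" "real (c i) \<le> real (d i) + 1"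
    if "i \<in> {1..2*k}" for i
  proof -
    have i: "1 \<le> i" "i \<le> 2 * k" using that by auto
    show N1: "N i \<ge> 1" using i kn by (simp add: N_def)
    show "\<alpha> i = (real q + 1) * N i" by (simp add: \<alpha>_def N_def)
    then show "\<alpha> i \<ge> real q * N i" using N1 by simp
    \<comment> \<open>The aim is \<open>c i \<le> N i\<close>: then a tilt of size
      \<open>\<epsilon> * q\<close> moves a shape by at most \<open>\<epsilon> * \<alpha> i\<close>,
      uniformly in the row.\<close>
    define r r' where "r = i div 2" and "r' = (i - 1) div 2"
    have r: "r' \<le> r" "r \<le> r' + 1" "i \<le> 2 * r' + 2" unfolding r_def r'_def by linarith+
    have cd: "c i = k - r'" "d i = k - r" by (simp_all add: c_def d_def r_def r'_def)
    have "2 * c i + i \<le> 2 * k + 2" unfolding cd using r i by linarith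
    then have "real (2 * c i + i) \<le> real (2 * n + 2)" using kn by (simp only: of_nat_le_iff)
    then show "c i \<le> N i" by (simp add: N_def)
    show "d i \<le> c i" unfolding cd using r by linarith
    have "c i \<le> d i + 1" unfolding cd using r by linarith
    then show "real (c i) \<le> real (d i) + 1" by linarith
  qed
  have \<alpha>0: "\<alpha> i > 0" if "i \<in> {1..2*k}" for i
  proof -
    have "0 < real q * N i" using iN(1)[OF that] q1 by (intro mult_pos_pos) linarith+
    then show ?thesis using iN(2)[OF that] by linarith
  qed
  have finJ: "finite J" by (simp add: J_def A1_def A2_def)
  have Jsub: "J \<subseteq> P_index n q <+> R_index n q"
    using kn mq by (auto simp: J_def A1_def A2_def P_index_def R_index_def)
  have dist: "distributed M lborel (Z x) (\<lambda>y. ennreal (beta_density (a x) (b x) y))" if "x \<in> J" for x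
  proof -
    have "x \<in> P_index n q <+> R_index n q" using Jsub that by auto
    then show ?thesis using arr
      by (auto simp: beta_array_def Z_def a_def b_def \<alpha>_def)
  qed
  have indZ: "indep_vars (\<lambda>_. borel) Z J"
  proof (rule indep_vars_subset[OF _ Jsub])
    show "indep_vars (\<lambda>_. borel) Z (P_index n q <+> R_index n q)"
      using arr unfolding beta_array_def Z_def by (elim conjE)
  qed
  have indY: "indep_vars (\<lambda>_. borel) Y J"
    unfolding Y_def[abs_def] by (rule indep_vars_compose2[OF indZ]) measurable
  have HY: "H n q P R s t \<omega> = (\<Sum>x\<in>J. Y x \<omega>)" for \<omega>
  proof -
    define F where "F i = (\<Sum>j\<in>{0..<m}. ln (P i j \<omega> ^ c i * (1 - P i j \<omega>) ^ d i)) + (\<Sum>j\<in>{1..<m}. ln (R i j \<omega> ^ d i))" for i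
    have "H n q P R s t \<omega> = (\<Sum>i\<in>{1..k}. F (2 * i) + F (2 * i - 1))"
      unfolding H_def Let_def k[symmetric] m[symmetric]
    proof (rule sum.cong[OF refl])
      fix i assume "i \<in> {1..k}"
      then have i: "1 \<le> i" "i \<le> k" by auto
      obtain l where l: "i = Suc l" using i by (cases i) auto
      have c1: "c (2 * i) = k - i + 1" using i by (simp add: c_def l)
      have c2: "c (2 * i - 1) = k - i + 1" using i by (simp add: c_def l)
      have d1: "d (2 * i) = k - i" by (simp add: d_def)
      have d2: "d (2 * i - 1) = k - i + 1" using i by (simp add: d_def l)
      show "(\<Sum>j\<in>{1..<m}. ln (R (2*i) j \<omega> ^ (k - i)) + ln (R (2*i - 1) j \<omega> ^ (k - i + 1)))
        + (\<Sum>j\<in>{0..<m}. ln (P (2*i) j \<omega> ^ (k - i + 1) * (1 - P (2*i) j \<omega>) ^ (k - i)))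
        + (\<Sum>j\<in>{0..<m}. ln (P (2*i - 1) j \<omega> ^ (k - i + 1) * (1 - P (2*i - 1) j \<omega>) ^ (k - i + 1)))
        = F (2 * i) + F (2 * i - 1)"
        unfolding F_def c1 c2 d1 d2 sum.distrib by (simp only: add_ac)
    qed
    also have "\<dots> = (\<Sum>i\<in>{1..2*k}. F i)" by (rule sum_pair_odd_even)
    also have "\<dots> = (\<Sum>x\<in>J. Y x \<omega>)"
      by (simp add: F_def J_def A1_def A2_def sum.Plus sum.distrib sum.cartesian_product Y_def Z_def C_def D_def
          o_def split_beta)
    finally show ?thesis .
  qed
  have Ymeas: "Y x \<in> borel_measurable M" if "x \<in> J" for x
    using indY that by (auto simp: indep_vars_def)
  \<comment> \<open>The common radius q/2 works because \<open>a x\<close> is at least q N i / 2,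
    while the exponents are at most \<open>N i\<close>. The shape j/2 of an \<open>r\<close> is
    never shifted.\<close>
  have small: "a x > 0" "b x > 0" "\<bar>C x * u\<bar> < a x" "\<bar>D x * u\<bar> < b x"
    if x: "x \<in> J" and u: "\<bar>u\<bar> < real q / 2" for x and u :: real
  proof -
    have "a x > 0 \<and> b x > 0 \<and> \<bar>C x * u\<bar> < a x \<and> \<bar>D x * u\<bar> < b x"
    proof -
      from x obtain i j where ij: "i \<in> {1..2*k}" "j < m" "x = Inl (i, j) \<or> x = Inr (i, j) \<and> 1 \<le> j"
        by (auto simp: J_def A1_def A2_def)
      note i = iN[OF ij(1)]
      have qN: "real q \<le> real q * N i" using i q1 by simp
      have jq: "real j \<le> real q * N i" using ij mq qN by (smt (verit) of_nat_less_iff order_less_le_trans)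
      have e: "\<bar>real e * u\<bar> < real q * N i / 2" if "real e \<le> N i" for e :: nat
      proof -
        have "\<bar>real e * u\<bar> \<le> N i * \<bar>u\<bar>" using that by (simp add: abs_mult mult_right_mono)
        also have "\<dots> < N i * (real q / 2)" using u i by (intro mult_strict_left_mono) auto
        finally show ?thesis by (simp add: mult.commute)
      qed
      have cd: "real (c i) \<le> N i" "real (d i) \<le> N i" using i by linarith+
      have \<alpha>i: "real q * N i \<le> \<alpha> i" "0 < real q * N i" using i(2) qN q1 by linarith+
      from ij(3) show ?thesis
      proof (elim disjE conjE)
        assume x: "x = Inl (i, j)"
        have eqs: "a x = \<alpha> i - real j / 2" "b x = \<alpha> i" "C x = c i" "D x = d i"
          by (simp_all add: x a_def b_def C_def D_def)
        show ?thesis unfolding eqs using e[OF cd(1)] e[OF cd(2)] jq \<alpha>i by (intro conjI) linarith+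
      next
        assume x: "x = Inr (i, j)" and j: "1 \<le> j"
        have eqs: "a x = \<alpha> i - real j / 2" "b x = real j / 2" "C x = d i" "real (D x) * u = 0"
          by (simp_all add: x a_def b_def C_def D_def)
        show ?thesis unfolding eqs using e[OF cd(2)] jq \<alpha>i j by (intro conjI) linarith+
      qed
    qed
    then show "a x > 0" "b x > 0" "\<bar>C x * u\<bar> < a x" "\<bar>D x * u\<bar> < b x" by auto
  qed
  define K where "K x = beta_cgf (a x) (b x) (C x) (D x)" for x
  define K' where "K' x = beta_cgf' (a x) (b x) (C x) (D x) 0" for x
  have mgf: "integrable M (\<lambda>\<omega>. exp (u * Y x \<omega>))" "expectation (\<lambda>\<omega>. exp (u * Y x \<omega>)) = exp (K x u)"
    if "x \<in> J" "\<bar>u\<bar> < real q / 2" for x u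
    using beta_log_mgf[OF dist[OF that(1)] small(1,2)[OF that], of "C x" u "D x"] small(3,4)[OF that]
    unfolding Y_def K_def by auto
  have K0: "K x 0 = 0" for x by (simp add: K_def)
  have KD: "(K x has_real_derivative K' x) (at 0)" if "x \<in> J" for x
    unfolding K_def K'_def using small(1,2)[OF that, of 0] q by (intro beta_cgf_deriv) auto
  have \<theta>q: "\<bar>\<theta>\<bar> < real q / 2"
  proof -
    have "\<epsilon> * real q \<le> 1 / 4 * real q" using \<epsilon> by (intro mult_right_mono) auto
    then show ?thesis using \<theta> q1 by linarith
  qed
  have q2: "real q / 2 > 0" using q by simp
  note mgfH = centered_sum_mgf[OF finJ indY q2 mgf K0 KD HY \<theta>q]
  have taylor: "\<exists>\<xi>. \<bar>\<xi>\<bar> \<le> \<bar>\<theta>\<bar> \<and> K x \<theta> - \<theta> * K' x = \<theta>\<^sup>2 / 2 * beta_cgf'' (a x) (b x) (C x) (D x) \<xi>"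
    if "x \<in> J" for x
    using beta_cgf_taylor[OF small(3,4)[OF that \<theta>q]] unfolding K_def K'_def by metis
  have N\<xi>: "N i * \<bar>\<xi>\<bar> \<le> \<epsilon> * \<alpha> i" if "i \<in> {1..2*k}" "\<bar>\<xi>\<bar> \<le> \<bar>\<theta>\<bar>" for i \<xi>
  proof -
    have "N i * \<bar>\<xi>\<bar> \<le> N i * (\<epsilon> * q)" using iN[OF that(1)] that(2) \<theta> by (intro mult_left_mono) auto
    also have "\<dots> = \<epsilon> * (q * N i)" by simp
    also have "\<dots> \<le> \<epsilon> * \<alpha> i" using iN[OF that(1)] \<epsilon>0 by (intro mult_left_mono) auto
    finally show ?thesis .
  qed
  define L where "L x = K x \<theta> - \<theta> * K' x" for x
  define V where "V i j = (real (d i))\<^sup>2 * (real j / 2) / (\<alpha> i)\<^sup>2" for i j :: nat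
  have LP: "\<bar>L (Inl (i, j))\<bar> \<le> \<theta>\<^sup>2 / 2 * (28 / (real q)\<^sup>2 + 43 / (q * N i))" if "(i, j) \<in> A1" for i j
  proof -
    have x: "Inl (i, j) \<in> J" and i: "i \<in> {1..2*k}" and j: "j < m" using that by (auto simp: J_def A1_def)
    obtain \<xi> where \<xi>: "\<bar>\<xi>\<bar> \<le> \<bar>\<theta>\<bar>" "L (Inl (i, j)) = \<theta>\<^sup>2 / 2 * beta_cgf'' (\<alpha> i - real j / 2) (\<alpha> i) (c i) (d i) \<xi>"
      using taylor[OF x] by (auto simp: L_def a_def b_def C_def D_def)
    have "\<epsilon> * \<alpha> i \<le> 1 / 4 * \<alpha> i" using \<epsilon> \<alpha>0[OF i] by (intro mult_right_mono) simp_all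
    then have N4: "N i * \<bar>\<xi>\<bar> \<le> \<alpha> i / 4" using N\<xi>[OF i \<xi>(1)] by linarith
    have "\<bar>beta_cgf'' (\<alpha> i - real j / 2) (\<alpha> i) (c i) (d i) \<xi>\<bar> \<le> 28 / (real q)\<^sup>2 + 43 / (q * N i)"
    proof (rule beta_cgf''_P_bound[OF q1 iN(1,2)[OF i] _ _ iN(4,6)[OF i] _ _ N4])
      show "real (d i) \<le> real (c i)" using iN(5)[OF i] by simp
      show "real j \<le> real q" using j mq by simp
    qed simp_all
    then have "\<theta>\<^sup>2 / 2 * \<bar>beta_cgf'' (\<alpha> i - real j / 2) (\<alpha> i) (c i) (d i) \<xi>\<bar> \<le> \<theta>\<^sup>2 / 2 * (28 / (real q)\<^sup>2 + 43 / (q * N i))"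
      by (intro mult_left_mono) auto
    then show ?thesis unfolding \<xi> by (simp add: abs_mult)
  qed
  have LR: "\<bar>L (Inr (i, j)) - \<theta>\<^sup>2 / 2 * V i j\<bar> \<le> \<theta>\<^sup>2 / 2 * (18 / (real q)\<^sup>2 + 2 / (q * N i) + 12 * \<epsilon> / q)" if "(i, j) \<in> A2" for i j
  proof -
    have x: "Inr (i, j) \<in> J" and i: "i \<in> {1..2*k}" and j: "1 \<le> j" "j < m" using that by (auto simp: J_def A2_def)
    obtain \<xi> where \<xi>: "\<bar>\<xi>\<bar> \<le> \<bar>\<theta>\<bar>" "L (Inr (i, j)) = \<theta>\<^sup>2 / 2 * beta_cgf'' (\<alpha> i - real j / 2) (real j / 2) (d i) 0 \<xi>"
      using taylor[OF x] by (auto simp: L_def a_def b_def C_def D_def)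
    have dN: "real (d i) \<le> N i" using iN[OF i] by linarith
    have "\<bar>beta_cgf'' (\<alpha> i - real j / 2) (real j / 2) (d i) 0 \<xi> - V i j\<bar> \<le> 18 / (real q)\<^sup>2 + 2 / (q * N i) + 12 * \<epsilon> / q"
      unfolding V_def
    proof (rule beta_cgf''_R_bound[OF q1 iN(1,2)[OF i] _ dN _ _ N\<xi>[OF i \<xi>(1)] \<epsilon>])
      show "0 < real j" "real j \<le> real q" using j mq by simp_all
    qed simp
    then have "\<theta>\<^sup>2 / 2 * \<bar>beta_cgf'' (\<alpha> i - real j / 2) (real j / 2) (d i) 0 \<xi> - V i j\<bar>
        \<le> \<theta>\<^sup>2 / 2 * (18 / (real q)\<^sup>2 + 2 / (q * N i) + 12 * \<epsilon> / q)"
      by (intro mult_left_mono) auto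
    moreover have eq: "L (Inr (i, j)) - \<theta>\<^sup>2 / 2 * V i j
      = \<theta>\<^sup>2 / 2 * (beta_cgf'' (\<alpha> i - real j / 2) (real j / 2) (d i) 0 \<xi> - V i j)"
      unfolding \<xi> by (simp add: right_diff_distrib)
    ultimately show ?thesis unfolding eq abs_mult by simp
  qed
  let ?EP = "\<lambda>i. 28 / (real q)\<^sup>2 + 43 / (q * N i)"
  let ?ER = "\<lambda>i. 18 / (real q)\<^sup>2 + 2 / (q * N i) + 12 * \<epsilon> / q"
  have EP0: "?EP i \<ge> 0" and ER0: "?ER i \<ge> 0" if "i \<in> {1..2*k}" for i
    using iN(1)[OF that] q1 \<epsilon>0 by (auto intro!: add_nonneg_nonneg)
  have SP: "\<bar>\<Sum>p\<in>A1. L (Inl p)\<bar> \<le> \<theta>\<^sup>2 / 2 * (\<Sum>i\<in>{1..2*k}. q * ?EP i)"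
  proof -
    have "\<bar>\<Sum>p\<in>A1. L (Inl p)\<bar> \<le> (\<Sum>p\<in>A1. \<theta>\<^sup>2 / 2 * ?EP (fst p))"
      using LP by (intro sum_abs[THEN order_trans] sum_mono) auto
    also have "\<dots> = (\<Sum>i\<in>{1..2*k}. m * (\<theta>\<^sup>2 / 2 * ?EP i))"
      unfolding A1_def sum_Times_fst[where f = "\<lambda>i. \<theta>\<^sup>2 / 2 * ?EP i"] by simp
    also have "\<dots> \<le> (\<Sum>i\<in>{1..2*k}. q * (\<theta>\<^sup>2 / 2 * ?EP i))"
      using mq EP0 by (intro sum_mono mult_right_mono mult_nonneg_nonneg) auto
    finally show ?thesis by (simp add: sum_distrib_left mult_ac)
  qed
  have SR: "\<bar>\<Sum>p\<in>A2. L (Inr p) - \<theta>\<^sup>2 / 2 * V (fst p) (snd p)\<bar> \<le> \<theta>\<^sup>2 / 2 * (\<Sum>i\<in>{1..2*k}. q * ?ER i)"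
  proof -
    have "\<bar>\<Sum>p\<in>A2. L (Inr p) - \<theta>\<^sup>2 / 2 * V (fst p) (snd p)\<bar> \<le> (\<Sum>p\<in>A2. \<theta>\<^sup>2 / 2 * ?ER (fst p))"
      using LR by (intro sum_abs[THEN order_trans] sum_mono) auto
    also have "\<dots> = (\<Sum>i\<in>{1..2*k}. real (m - 1) * (\<theta>\<^sup>2 / 2 * ?ER i))"
      unfolding A2_def sum_Times_fst[where f = "\<lambda>i. \<theta>\<^sup>2 / 2 * ?ER i"] by simp
    also have "\<dots> \<le> (\<Sum>i\<in>{1..2*k}. q * (\<theta>\<^sup>2 / 2 * ?ER i))"
      using mq ER0 by (intro sum_mono mult_right_mono mult_nonneg_nonneg) auto
    finally show ?thesis by (simp add: sum_distrib_left mult_ac)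
  qed
  have SV: "(\<Sum>p\<in>A2. V (fst p) (snd p)) = (\<Sum>i\<in>{1..2*k}. (real (k - i div 2) / N i)\<^sup>2) * (real m * (real m - 1) / 4) / (real q + 1)\<^sup>2"
  proof -
    have "(\<Sum>p\<in>A2. V (fst p) (snd p)) = (\<Sum>i\<in>{1..2*k}. \<Sum>j\<in>{1..<m}. V i j)"
      unfolding A2_def by (simp add: sum.cartesian_product split_beta)
    also have "\<dots> = (\<Sum>i\<in>{1..2*k}. (real (d i))\<^sup>2 / (\<alpha> i)\<^sup>2 * (\<Sum>j\<in>{1..<m}. real j / 2))"
      unfolding sum_distrib_left by (intro sum.cong refl) (simp add: V_def)
    also have "\<dots> = (\<Sum>i\<in>{1..2*k}. (real (k - i div 2) / N i)\<^sup>2 * (real m * (real m - 1) / 4) / (real q + 1)\<^sup>2)"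
      unfolding sum_real_lt
      by (intro sum.cong refl) (simp add: iN(3) d_def power_divide power_mult_distrib mult_ac)
    finally show ?thesis by (simp add: sum_distrib_right sum_divide_distrib)
  qed
  have SL: "(\<Sum>x\<in>J. L x) = (\<Sum>p\<in>A1. L (Inl p)) + (\<Sum>p\<in>A2. L (Inr p))"
    unfolding J_def by (subst sum.Plus) (simp_all add: A1_def A2_def o_def)
  \<comment> \<open>A row has at most \<open>q\<close> entries of each kind, so the entrywise bounds
    are multiplied by \<open>q\<close>; 46 = 28 + 18 and 45 = 43 + 2.\<close>
  have SE: "(\<Sum>i\<in>{1..2*k}. q * ?EP i) + (\<Sum>i\<in>{1..2*k}. q * ?ER i) = (\<Sum>i\<in>{1..2*k}. 46 / q + 45 / N i + 12 * \<epsilon>)"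
    unfolding sum.distrib[symmetric]
  proof (rule sum.cong[OF refl])
    fix i assume "i \<in> {1..2*k}"
    then have "N i \<ge> 1" by (rule iN)
    then show "q * ?EP i + q * ?ER i = 46 / q + 45 / N i + 12 * \<epsilon>"
      using q1 by (simp add: field_simps power2_eq_square)
  qed
  have "(\<Sum>x\<in>J. L x) - \<theta>\<^sup>2 / 2 * (\<Sum>p\<in>A2. V (fst p) (snd p))
     = (\<Sum>p\<in>A1. L (Inl p)) + (\<Sum>p\<in>A2. L (Inr p) - \<theta>\<^sup>2 / 2 * V (fst p) (snd p))"
    unfolding SL sum_subtractf sum_distrib_left by simp
  then have bound: "\<bar>(\<Sum>x\<in>J. L x) - \<theta>\<^sup>2 / 2 * (\<Sum>p\<in>A2. V (fst p) (snd p))\<bar>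
      \<le> \<theta>\<^sup>2 / 2 * (\<Sum>i\<in>{1..2*k}. 46 / q + 45 / N i + 12 * \<epsilon>)"
    using SP SR unfolding SE[symmetric] distrib_left by linarith
  show ?thesis
  proof (rule that[OF _ _ _ bound[unfolded SV]])
    have "(\<lambda>\<omega>. \<Sum>x\<in>J. Y x \<omega>) \<in> borel_measurable M" using Ymeas by (rule borel_measurable_sum)
    then show "H n q P R s t \<in> borel_measurable M" by (simp add: HY[abs_def])
    show "integrable M (\<lambda>\<omega>. exp (\<theta> * (H n q P R s t \<omega> - expectation (H n q P R s t))))"
      "expectation (\<lambda>\<omega>. exp (\<theta> * (H n q P R s t \<omega> - expectation (H n q P R s t)))) = exp (\<Sum>x\<in>J. L x)"
      using mgfH unfolding L_def by auto
  qed
qed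

section \<open>Goodness of the rate function and passage to the limit\<close>

lemma good_rate_function_quadratic:
  assumes "v > 0"
  shows "good_rate_function (\<lambda>x. ereal (x\<^sup>2 / (2 * v)))"
  unfolding good_rate_function_def
proof (intro conjI allI)
  show "0 \<le> ereal (x\<^sup>2 / (2 * v))" for x using assms by simp
  fix c :: real
  have eq: "{x. ereal (x\<^sup>2 / (2 * v)) \<le> ereal c} = {x. x\<^sup>2 \<le> 2 * v * c}"
    using assms by (auto simp: field_simps)
  have "closed {x::real. x\<^sup>2 \<le> 2 * v * c}"
    by (intro closed_Collect_le continuous_intros)
  moreover have "bounded {x::real. x\<^sup>2 \<le> 2 * v * c}"
  proof (rule boundedI)
    fix x assume "x \<in> {x::real. x\<^sup>2 \<le> 2 * v * c}"
    \<comment> \<open>This bounds the sublevel set without a square root, so negative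
      \<open>c\<close> needs no separate case.\<close>
    moreover have "2 * \<bar>x\<bar> \<le> x\<^sup>2 + 1"
      using zero_le_power2[of "\<bar>x\<bar> - 1"] by (simp add: power2_diff)
    ultimately show "norm x \<le> (2 * v * c + 1) / 2" by simp
  qed
  ultimately show "compact {x. ereal (x\<^sup>2 / (2 * v)) \<le> ereal c}"
    unfolding eq by (simp add: compact_eq_bounded_closed)
qed

text \<open>Dividing by p + 1 turns the expression into a polynomial in m/(p + 1), which tends to
  \<open>s\<close>, and 1/(p + 1), which tends to 0. The floor and the added 1 displace
  \<open>m\<close> from s (p + 1) by at most 2.\<close>

lemma floor_square_ratio_tendsto:
  fixes s :: real
  assumes s: "0 < s" "s \<le> 1" and p: "filterlim p at_top sequentially"
  defines "m \<equiv> \<lambda>n. nat \<lfloor>real (p n) * s\<rfloor>"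
  shows "(\<lambda>n. real (m n) * (real (m n) - 1) / 4 / (real (p n) + 1)\<^sup>2) \<longlonglongrightarrow> s\<^sup>2 / 4"
proof -
  define x where "x n = inverse (real (Suc (p n)))" for n
  have x: "x \<longlonglongrightarrow> 0"
    unfolding x_def by (rule filterlim_compose[OF LIMSEQ_inverse_real_of_nat p])
  have "(\<lambda>n. real (m n) * x n - s) \<longlonglongrightarrow> 0"
  proof (rule Lim_null_comparison)
    show "(\<lambda>n. 2 * x n) \<longlonglongrightarrow> 0" using tendsto_mult_right_zero[OF x, of 2] by simp
    show "\<forall>\<^sub>F n in sequentially. norm (real (m n) * x n - s) \<le> 2 * x n"
    proof (rule always_eventually, rule)
      fix n
      have pos: "x n > 0" "x n * (real (p n) + 1) = 1" by (simp_all add: x_def field_simps)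
      have "real (p n) * s \<ge> 0" using s by simp
      then have "real (m n) \<le> real (p n) * s" "real (p n) * s < real (m n) + 1"
        unfolding m_def by linarith+
      then have "\<bar>real (m n) - s * (real (p n) + 1)\<bar> \<le> 2"
        using s by (simp add: algebra_simps abs_le_iff)
      then have "x n * \<bar>real (m n) - s * (real (p n) + 1)\<bar> \<le> x n * 2"
        using pos by (intro mult_left_mono) auto
      moreover have "real (m n) * x n - s = x n * (real (m n) - s * (real (p n) + 1))"
      proof -
        have "s = s * (x n * (real (p n) + 1))" using pos by simp
        then show ?thesis by (simp add: algebra_simps)
      qed
      ultimately show "norm (real (m n) * x n - s) \<le> 2 * x n"
        using pos by (simp add: abs_mult)
    qed
  qed
  from tendsto_add[OF this tendsto_const[of s]] have 1: "(\<lambda>n. real (m n) * x n) \<longlonglongrightarrow> s" by simp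
  have 2: "(\<lambda>n. (real (m n) * x n) * (real (m n) * x n - x n) / 4) \<longlonglongrightarrow> s * (s - 0) / 4"
    by (intro tendsto_intros 1 x) simp
  have eq: "real (m n) * (real (m n) - 1) / 4 / (real (p n) + 1)\<^sup>2 = (real (m n) * x n) * (real (m n) * x n - x n) / 4" for n
  proof -
    have "real (m n) * (real (m n) - 1) / 4 / (real (p n) + 1)\<^sup>2 = real (m n) * (real (m n) - 1) / 4 * (x n)\<^sup>2"
      unfolding x_def inverse_eq_divide power_divide by (simp add: add.commute)
    also have "\<dots> = (real (m n) * x n) * (real (m n) * x n - x n) / 4"
      by (simp add: power2_eq_square left_diff_distrib right_diff_distrib)
    finally show ?thesis .
  qed
  have "s * (s - 0) / 4 = s\<^sup>2 / 4" by (simp add: power2_eq_square)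
  with 2 show ?thesis by (simp only: eq)
qed

theorem theorem5p5:
  fixes M :: "nat \<Rightarrow> 'a measure"
    and p :: "nat \<Rightarrow> nat"
    and P R :: "nat \<Rightarrow> nat \<Rightarrow> nat \<Rightarrow> 'a \<Rightarrow> real"
    and a :: "nat \<Rightarrow> real"
    and s t :: real
  assumes prob: "\<And>n. n \<ge> 1 \<Longrightarrow> prob_space (M n)"
    and array: "\<And>n. n \<ge> 1 \<Longrightarrow> beta_array (M n) n (p n) (P n) (R n)"
    and p_pos: "\<And>n. n \<ge> 1 \<Longrightarrow> p n > 0"
    and p_lim: "filterlim p at_top sequentially"
    and s: "0 < s" "s \<le> 1"
    and t: "0 < t" "t \<le> 1"
    and a_pos: "\<And>n. n \<ge> 1 \<Longrightarrow> a n > 0"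
    and a_lower: "(\<lambda>n. sqrt (real n)) \<in> o(a)"
    and a_upper: "a \<in> o(\<lambda>n. real n * real (p n))"
  defines "X \<equiv> \<lambda>n \<omega>. (H n (p n) (P n) (R n) s t \<omega>
                        - integral\<^sup>L (M n) (H n (p n) (P n) (R n) s t)) / a n"
    and "I \<equiv> \<lambda>x. ereal (x\<^sup>2 * inverse (s\<^sup>2 * integral {0..t} (\<lambda>y. ((t - y) / (1 - y))\<^sup>2)))"
  shows "good_rate_function I \<and> satisfies_LDP M X (\<lambda>n. (a n)\<^sup>2 / real n) I"
proof -
  define J where "J = integral {0..t} (\<lambda>y. ((t - y) / (1 - y))\<^sup>2)"
  have J: "J > 0" unfolding J_def by (rule limit_integral_pos[OF t])
  \<comment> \<open>The limit of the variance of H divided by n: 2 J from the rows times s^2 / 4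
    from the columns.\<close>
  define v where "v = s\<^sup>2 / 2 * J"
  have v: "v > 0" using J s by (simp add: v_def)
  have I: "I = (\<lambda>x. ereal (x\<^sup>2 / (2 * v)))"
    unfolding I_def J_def[symmetric] v_def by (simp add: inverse_eq_divide)
  define b where "b n = (a n)\<^sup>2 / real n" for n
  define k where "k n = nat \<lfloor>real n * t\<rfloor>" for n
  define m where "m n = nat \<lfloor>real (p n) * s\<rfloor>" for n
  define N where "N n i = (2 * real n - real i + 2) / 2" for n i :: nat
  define W where "W n = (\<Sum>i\<in>{1..2 * k n}. (real (k n - i div 2) / N n i)\<^sup>2)" for n
  define \<mu> where "\<mu> n = real (m n) * (real (m n) - 1) / 4 / (real (p n) + 1)\<^sup>2" for n
  \<comment> \<open>Chosen so that |\<open>\<theta> u n\<close>| =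
    \<open>\<epsilon> u n * p n\<close>, where \<open>\<theta> u n\<close> is the tilt of H that
    corresponds to the tilt \<open>u * b n\<close> of \<open>X n\<close>. It tends to 0 by
    \<open>a_upper\<close>.\<close>
  define \<epsilon> where "\<epsilon> u n = \<bar>u\<bar> * (a n / (real n * real (p n)))" for u n
  define \<theta> where "\<theta> u n = u * a n / real n" for u n
  define L where "L u n = ln (\<integral>\<omega>. exp (u * b n * X n \<omega>) \<partial>M n) / b n" for u n
  \<comment> \<open>The summed error of \<open>H_mgf\<close> divided by n: at most 2n rows double 46
    and 12, and 45 / N i <= 90 / (2n - i + 1) sums to at most 180 sqrt(2n).\<close>
  define E where "E u n = 92 / real (p n) + 180 * (sqrt 2 * inverse (sqrt (real n))) + 24 * \<epsilon> u n" for u n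

  have anz: "\<forall>\<^sub>F n in sequentially. a n \<noteq> 0"
    using eventually_ge_at_top[of 1]
  proof eventually_elim
    case (elim n)
    then show ?case using a_pos[of n] by simp
  qed
  have \<epsilon>0: "\<epsilon> u \<longlonglongrightarrow> 0" for u
    unfolding \<epsilon>_def using tendsto_mult_right_zero[OF smalloD_tendsto[OF a_upper], of "\<bar>u\<bar>"] by simp
  have inv_p: "(\<lambda>n. inverse (real (p n))) \<longlonglongrightarrow> 0"
    by (rule tendsto_inverse_0_at_top, rule filterlim_compose[OF filterlim_real_sequentially p_lim])
  have inv_sqrt: "(\<lambda>n. inverse (sqrt (real n))) \<longlonglongrightarrow> 0"
    by (rule tendsto_inverse_0_at_top, rule filterlim_compose[OF sqrt_at_top filterlim_real_sequentially])
  have E0: "E u \<longlonglongrightarrow> 0" for u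
  proof -
    have "(\<lambda>n. 92 * inverse (real (p n)) + 180 * (sqrt 2 * inverse (sqrt (real n))) + 24 * \<epsilon> u n)
        \<longlonglongrightarrow> 92 * 0 + 180 * (sqrt 2 * 0) + 24 * 0"
      by (intro tendsto_intros inv_p inv_sqrt \<epsilon>0)
    then show ?thesis by (simp add: E_def[abs_def] divide_inverse)
  qed

  have b_top: "filterlim b at_top sequentially"
  proof -
    have "(\<lambda>n. (sqrt (real n) / a n)\<^sup>2) \<longlonglongrightarrow> 0\<^sup>2"
      by (intro tendsto_power smalloD_tendsto[OF a_lower])
    moreover have "\<forall>\<^sub>F n in sequentially. 0 < (sqrt (real n) / a n)\<^sup>2"
      using eventually_gt_at_top[of 0] anz by eventually_elim simp
    ultimately have "filterlim (\<lambda>n. inverse ((sqrt (real n) / a n)\<^sup>2)) at_top sequentially"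
      by (intro filterlim_inverse_at_top) simp_all
    then show ?thesis by (simp add: b_def[abs_def] power_divide)
  qed

  have W_lim: "(\<lambda>n. W n / (2 * real n)) \<longlonglongrightarrow> J"
  proof -
    have "(\<lambda>n. W n / (2 * real n) - J) \<longlonglongrightarrow> 0"
    proof (rule Lim_null_comparison)
      show "\<forall>\<^sub>F n in sequentially. norm (W n / (2 * real n) - J) \<le> 8 * sqrt 2 * inverse (sqrt (real n)) + 3/2 * inverse (real n)"
        using eventually_ge_at_top[of 1]
      proof eventually_elim
        case (elim n)
        have "norm (W n / (2 * real n) - J) \<le> (16 * sqrt (2 * real n) + 3) / (2 * real n)"
          using ratio_sq_sum_approx[OF elim t k_def] unfolding W_def N_def J_def by simp
        also have "\<dots> = 8 * sqrt 2 * inverse (sqrt (real n)) + 3/2 * inverse (real n)"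
          using elim by (simp add: real_sqrt_mult field_simps)
        finally show ?case .
      qed
      have "(\<lambda>n. 8 * sqrt 2 * inverse (sqrt (real n)) + 3/2 * inverse (real n)) \<longlonglongrightarrow> 8 * sqrt 2 * 0 + 3/2 * 0"
        by (intro tendsto_intros inv_sqrt lim_inverse_n)
      then show "(\<lambda>n. 8 * sqrt 2 * inverse (sqrt (real n)) + 3/2 * inverse (real n)) \<longlonglongrightarrow> 0" by simp
    qed
    from tendsto_add[OF this tendsto_const[of J]] show ?thesis by simp
  qed
  have V_lim: "(\<lambda>n. W n * \<mu> n / real n) \<longlonglongrightarrow> v"
  proof -
    have "\<mu> \<longlonglongrightarrow> s\<^sup>2 / 4"
      unfolding \<mu>_def[abs_def] m_def by (rule floor_square_ratio_tendsto[OF s p_lim])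
    then have "(\<lambda>n. 2 * (W n / (2 * real n)) * \<mu> n) \<longlonglongrightarrow> 2 * J * (s\<^sup>2 / 4)"
      by (intro tendsto_intros W_lim)
    then show ?thesis by (simp add: v_def mult_ac)
  qed

  have key: "\<forall>\<^sub>F n in sequentially.
      integrable (M n) (\<lambda>\<omega>. exp (u * b n * X n \<omega>)) \<and>
      (\<integral>\<omega>. exp (u * b n * X n \<omega>) \<partial>M n) = exp (b n * L u n) \<and>
      \<bar>L u n - u\<^sup>2 / 2 * (W n * \<mu> n / real n)\<bar> \<le> u\<^sup>2 / 2 * E u n" for u
  proof -
    have "\<forall>\<^sub>F n in sequentially. \<epsilon> u n < 1 / 4"
      by (rule order_tendstoD(2)[OF \<epsilon>0]) simp
    then show ?thesis using eventually_ge_at_top[of 1]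
    proof eventually_elim
      case (elim n)
      interpret prob_space "M n" using elim by (intro prob) auto
      have n: "real n > 0" and pn: "real (p n) > 0" "1 \<le> p n" and an: "a n > 0"
        using elim p_pos[of n] a_pos[of n] by auto
      have bn: "b n > 0" using n an by (simp add: b_def)
      have \<theta>\<epsilon>: "\<bar>\<theta> u n\<bar> \<le> \<epsilon> u n * real (p n)"
        using n pn an by (simp add: \<theta>_def \<epsilon>_def abs_mult)
      have \<epsilon>4: "\<epsilon> u n \<le> 1 / 4" using elim by simp
      obtain \<Lambda> where \<Lambda>:
        "integrable (M n) (\<lambda>\<omega>. exp (\<theta> u n * (H n (p n) (P n) (R n) s t \<omega> - expectation (H n (p n) (P n) (R n) s t))))"
        "expectation (\<lambda>\<omega>. exp (\<theta> u n * (H n (p n) (P n) (R n) s t \<omega> - expectation (H n (p n) (P n) (R n) s t)))) = exp \<Lambda>"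
        "\<bar>\<Lambda> - (\<theta> u n)\<^sup>2 / 2 * (W n * (real (m n) * (real (m n) - 1) / 4) / (real (p n) + 1)\<^sup>2)\<bar>
          \<le> (\<theta> u n)\<^sup>2 / 2 * (\<Sum>i\<in>{1..2 * k n}. 46 / real (p n) + 45 / N n i + 12 * \<epsilon> u n)"
        unfolding W_def N_def
        by (rule H_mgf[OF elim(2) pn(2) array[OF elim(2)] s t \<theta>\<epsilon> \<epsilon>4 k_def m_def])
      have ubX: "u * b n * X n \<omega> = \<theta> u n * (H n (p n) (P n) (R n) s t \<omega> - expectation (H n (p n) (P n) (R n) s t))" for \<omega>
        using an by (simp add: X_def b_def \<theta>_def power2_eq_square)
      have int: "integrable (M n) (\<lambda>\<omega>. exp (u * b n * X n \<omega>))"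
        and ex: "expectation (\<lambda>\<omega>. exp (u * b n * X n \<omega>)) = exp \<Lambda>"
        using \<Lambda> unfolding ubX by auto
      have L: "L u n = \<Lambda> / b n" unfolding L_def ex by simp
      have kn: "2 * k n \<le> 2 * n"
      proof -
        have "real n * t \<le> real n" using t by (simp add: mult_left_le)
        then show ?thesis unfolding k_def by linarith
      qed
      have \<epsilon>pos: "\<epsilon> u n \<ge> 0" using n pn an by (simp add: \<epsilon>_def)
      have "(\<Sum>i\<in>{1..2 * k n}. 46 / real (p n) + 45 / N n i + 12 * \<epsilon> u n)
          \<le> (\<Sum>i\<in>{1..2 * k n}. (46 / real (p n) + 12 * \<epsilon> u n) + 90 * (1 / (real (2 * n) - real i + 1)))"
      proof (rule sum_mono)
        fix i assume "i \<in> {1..2 * k n}"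
        then have "real i \<le> 2 * real n" using kn by auto
        then have "45 / N n i \<le> 90 * (1 / (real (2 * n) - real i + 1))"
          unfolding N_def by (simp add: field_simps)
        then show "46 / real (p n) + 45 / N n i + 12 * \<epsilon> u n
          \<le> (46 / real (p n) + 12 * \<epsilon> u n) + 90 * (1 / (real (2 * n) - real i + 1))" by linarith
      qed
      also have "\<dots> = real (2 * k n) * (46 / real (p n) + 12 * \<epsilon> u n)
          + 90 * (\<Sum>i\<in>{1..2 * k n}. 1 / (real (2 * n) - real i + 1))"
        unfolding sum.distrib sum_distrib_left by (simp add: distrib_left)
      also have "\<dots> \<le> real (2 * n) * (46 / real (p n) + 12 * \<epsilon> u n) + 90 * (2 * sqrt (real (2 * n)))"
      proof (intro add_mono mult_right_mono)
        show "90 * (\<Sum>i\<in>{1..2 * k n}. 1 / (real (2 * n) - real i + 1)) \<le> 90 * (2 * sqrt (real (2 * n)))"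
          using sum_shifted_reciprocals_le[OF kn] by linarith
        show "real (2 * k n) \<le> real (2 * n)" using kn by (simp only: of_nat_le_iff)
        show "0 \<le> 46 / real (p n) + 12 * \<epsilon> u n" using pn \<epsilon>pos by simp
      qed
      also have "\<dots> = real n * E u n"
        using n unfolding E_def by (simp add: real_sqrt_mult field_simps)
      finally have err: "(\<Sum>i\<in>{1..2 * k n}. 46 / real (p n) + 45 / N n i + 12 * \<epsilon> u n) \<le> real n * E u n" .
      have \<theta>b: "(\<theta> u n)\<^sup>2 / 2 = b n * (u\<^sup>2 / 2 / real n)"
        by (simp add: \<theta>_def b_def power2_eq_square mult_ac)
      have W\<mu>: "W n * (real (m n) * (real (m n) - 1) / 4) / (real (p n) + 1)\<^sup>2 = W n * \<mu> n" by (simp add: \<mu>_def)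
      have "\<bar>\<Lambda> - b n * (u\<^sup>2 / 2 / real n) * (W n * \<mu> n)\<bar> \<le> b n * (u\<^sup>2 / 2 / real n) * (real n * E u n)"
        using \<Lambda>(3) err bn n unfolding \<theta>b W\<mu> by (elim order_trans) (intro mult_left_mono, auto)
      also have "\<Lambda> - b n * (u\<^sup>2 / 2 / real n) * (W n * \<mu> n) = b n * (L u n - u\<^sup>2 / 2 * (W n * \<mu> n / real n))"
        using bn by (simp add: L right_diff_distrib)
      also have "b n * (u\<^sup>2 / 2 / real n) * (real n * E u n) = b n * (u\<^sup>2 / 2 * E u n)" using n by simp
      finally have "b n * \<bar>L u n - u\<^sup>2 / 2 * (W n * \<mu> n / real n)\<bar> \<le> b n * (u\<^sup>2 / 2 * E u n)"
        using bn by (simp add: abs_mult)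
      then have "\<bar>L u n - u\<^sup>2 / 2 * (W n * \<mu> n / real n)\<bar> \<le> u\<^sup>2 / 2 * E u n"
        using bn by (rule mult_left_le_imp_le)
      then show ?case using int ex bn by (simp add: L)
    qed
  qed

  have "satisfies_LDP M X b (\<lambda>x. ereal (x\<^sup>2 / (2 * v)))"
  proof (rule LDP_quadratic[OF v _ _ b_top])
    show "X n \<in> borel_measurable (M n)" for n
    proof (cases "n = 0")
      case True
      \<comment> \<open>Measurability is demanded for n = 0 too, where \<open>M 0\<close> is
        arbitrary; there H is an empty sum and \<open>X 0\<close> vanishes.\<close>
      have "H 0 (p 0) (P 0) (R 0) s t = (\<lambda>_. 0)" by (simp add: H_def fun_eq_iff)
      then have "X n = (\<lambda>_. 0)" unfolding X_def True by simp
      then show ?thesis by simp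
    next
      case False
      then have n: "1 \<le> n" "1 \<le> p n" using p_pos[of n] by auto
      interpret prob_space "M n" using n by (intro prob) auto
      \<comment> \<open>Only measurability is extracted from \<open>H_mgf\<close>, so the trivial
        tilt 0 will do.\<close>
      have "H n (p n) (P n) (R n) s t \<in> borel_measurable (M n)"
        by (rule H_mgf[OF n array[OF n(1)] s t, of 0 0]) auto
      then show ?thesis unfolding X_def by measurable
    qed
    show "\<forall>\<^sub>F n in sequentially. prob_space (M n)"
      using eventually_ge_at_top[of 1] by eventually_elim (rule prob)
    show "\<forall>\<^sub>F n in sequentially. integrable (M n) (\<lambda>\<omega>. exp (u * b n * X n \<omega>)) \<and>
      (\<integral>\<omega>. exp (u * b n * X n \<omega>) \<partial>M n) = exp (b n * L u n)" for u
      using key[of u] by eventually_elim simp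
    show "L u \<longlonglongrightarrow> u\<^sup>2 * v / 2" for u
    proof -
      have "(\<lambda>n. L u n - u\<^sup>2 / 2 * (W n * \<mu> n / real n)) \<longlonglongrightarrow> 0"
      proof (rule Lim_null_comparison)
        show "\<forall>\<^sub>F n in sequentially. norm (L u n - u\<^sup>2 / 2 * (W n * \<mu> n / real n)) \<le> u\<^sup>2 / 2 * E u n"
          using key[of u] by eventually_elim simp
        show "(\<lambda>n. u\<^sup>2 / 2 * E u n) \<longlonglongrightarrow> 0" by (rule tendsto_mult_right_zero[OF E0])
      qed
      from tendsto_add[OF this tendsto_mult_left[OF V_lim, of "u\<^sup>2 / 2"]]
      show ?thesis by simp
    qed
  qed
  then show ?thesis
    unfolding I using good_rate_function_quadratic[OF v] by (simp add: b_def[abs_def])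
qed

end
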